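(* Let $\mu,\nu$ be Borel probability measures on $[0,1)$. Assume that $\mu$ does not charge the boundaries of intervals in $\mathcal{D}$ (that is, $\mu(\{j2^{-k}\}) = 0$ for all integers $j,k\ge 0$), and that $\nu$ is dyadically doubling: there is $C \geq 1$ with $\nu(\hat I) \leq C\nu(I)$ for all $I \in \mathcal{D}\setminus\{[0,1)\}$. Write $\mu = \mu_a + \mu_s$ for the Lebesgue decomposition of $\mu$ relative to $\nu$ ($\mu_a \ll \nu$, $\mu_s \perp \nu$). Define the square function $$\mathcal{S}^2_{\mathcal{D},\nu}(\mu)(x) = \sum_{I \in \mathcal{D}} \alpha_{\mu,\nu}^2(I)\chi_I(x), \qquad x \in [0,1).$$ Then (a) $\mathcal{S}_{\mathcal{D},\nu}(\mu)(x) < \infty$ for $\mu_a$-almost every $x$, and (b) $\mathcal{S}_{\mathcal{D},\nu}(\mu)(x) = \infty$ for $\mu_s$-almost every $x$.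
   Context: $\mathcal{D}$ denotes the family of dyadic intervals $[j2^{-k},(j+1)2^{-k}) \subset [0,1)$, $k \geq 0$. For $I \in \mathcal{D}$, $\hat I$ is its parent (the smallest dyadic interval strictly containing $I$). Wasserstein distance: for finite Borel measures $\nu_1,\nu_2$ on $\mathbb{R}$, $\mathbb{W}_1(\nu_1,\nu_2) := \sup_\psi |\int\psi\,d\nu_1 - \int\psi\,d\nu_2|$, the supremum over all $1$-Lipschitz $\psi\colon\mathbb{R}\to\mathbb{R}$ supported on $[0,1]$. For an interval $I\subset\mathbb{R}$, $T_I$ is the increasing affine map taking $\overline{I}$ onto $[0,1]$, $\mu_I := T_{I\sharp}(\mu|_I)/\mu(I)$ and $\nu_I := T_{I\sharp}(\nu|_I)/\nu(I)$ (with $\mu_I :\equiv 0$ if $\mu(I)=0$, similarly for $\nu$), and $\alpha_{\mu,\nu}(I) := \mathbb{W}_1(\mu_I,\nu_I)$. *)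

theory Defs
  imports "HOL-Probability.Probability"
begin

text \<open>Dyadic interval I_{k,j} = [j 2^-k, (j+1) 2^-k); the family D is
  {dyadic_int k j | k j. j < 2^k}. Each I in D has a unique index (k,j).\<close>
definition dyadic_int :: "nat \<Rightarrow> nat \<Rightarrow> real set" where
  "dyadic_int k j = {real j / 2 ^ k ..< (real j + 1) / 2 ^ k}"

definition dyadic_parent :: "nat \<Rightarrow> nat \<Rightarrow> real set" where
  "dyadic_parent k j = dyadic_int (k - 1) (j div 2)"

definition W1 :: "real measure \<Rightarrow> real measure \<Rightarrow> real" where
  "W1 n1 n2 = Sup {\<bar>integral\<^sup>L n1 psi - integral\<^sup>L n2 psi\<bar> | psi :: real \<Rightarrow> real.
      lipschitz_on 1 UNIV psi \<and> (\<forall>x. x \<notin> {0..1} \<longrightarrow> psi x = 0)}"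

definition T_map :: "real \<Rightarrow> real \<Rightarrow> real \<Rightarrow> real" where
  "T_map a b x = (x - a) / (b - a)"

definition blowup :: "real measure \<Rightarrow> real \<Rightarrow> real \<Rightarrow> real measure" where
  "blowup m a b = (if emeasure m {a..<b} = 0 then null_measure borel
     else scale_measure (ennreal (1 / measure m {a..<b}))
            (distr (density m (indicator {a..<b})) borel (T_map a b)))"

definition alpha :: "real measure \<Rightarrow> real measure \<Rightarrow> real \<Rightarrow> real \<Rightarrow> real" where
  "alpha m n a b = W1 (blowup m a b) (blowup n a b)"

definition sqfun2 :: "real measure \<Rightarrow> real measure \<Rightarrow> real \<Rightarrow> ennreal" where
  "sqfun2 m n x = (\<Sum>k. \<Sum>j<2^k.
      ennreal ((alpha m n (real j / 2 ^ k) ((real j + 1) / 2 ^ k))\<^sup>2)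
        * indicator (dyadic_int k j) x)"

end

theory Submission
  imports Defs
begin

text \<open>Let \<open>\<Delta>(I)\<close> be the difference of the proportions of mass that \<open>\<mu>\<close> and \<open>\<nu>\<close> give to the left
  child of \<open>I\<close>.

  Finiteness: telescoping the Hellinger affinities \<open>\<Sum> sqrt (\<mu>(I) \<nu>(I))\<close> over the generations gives
  \<open>\<Sum> sqrt (\<mu>(I) \<nu>(I)) \<Delta>(I)\<^sup>2 \<le> 4\<close> over all dyadic \<open>I\<close>, hence control of
  \<open>\<Sum> \<mu>(I) \<Delta>(I)\<^sup>2\<close> over the intervals reached before \<open>\<mu>(I)/\<nu>(I)\<close> exceeds a level \<open>M\<close>.
  The Wasserstein distance without boundary condition satisfies
  \<open>W(I) \<le> |\<Delta>(I)| + (p W(I\<^sub>-) + (1 - p) W(I\<^sub>+)) / 2\<close>, where \<open>p = \<mu>(I\<^sub>-)/\<mu>(I)\<close>, so the factor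
  \<open>1/2\<close> transfers the control to \<open>\<Sum> \<mu>(I) W(I)\<^sup>2\<close>, and \<open>\<alpha> \<le> W\<close>. The density exceeds every
  level only on a \<open>\<nu>\<close>-null set.

  Divergence: testing with a tent over a child \<open>J\<close> of \<open>I\<close> gives, by doubling,
  \<open>|\<Delta>(I)| \<lesssim> \<alpha>(I) + \<alpha>(J)\<close>. So where the square function is finite, \<open>\<Sum> \<Delta>\<^sup>2\<close> converges, and there
  the \<open>\<mu>\<close>-supermartingale \<open>(\<mu>(I)/\<nu>(I)) / \<Prod> (1 + C\<^sup>2 \<Delta>\<^sup>2)\<close> keeps the density from tending to
  infinity; but on a \<open>\<nu>\<close>-null set the density does tend to infinity \<open>\<mu>\<close>-almost everywhere.\<close>

section \<open>Elementary inequalities and dyadic intervals\<close>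

text \<open>The right side is half the sum of the squares of \<open>sqrt p - sqrt q\<close> and
  \<open>sqrt (1 - p) - sqrt (1 - q)\<close>. Each square is at least a quarter of the squared
  difference of its arguments, because two square roots of numbers in [0,1] add up to at most
  2.\<close>

lemma hellinger_ge_square_diff:
  fixes p q :: real
  assumes "0 \<le> p" "p \<le> 1" "0 \<le> q" "q \<le> 1"
  shows "(p - q)\<^sup>2 / 4 \<le> 1 - sqrt (p * q) - sqrt ((1 - p) * (1 - q))"
proof -
  have aux: "(a - b)\<^sup>2 / 4 \<le> (sqrt a - sqrt b)\<^sup>2"
    if "0 \<le> a" "a \<le> 1" "0 \<le> b" "b \<le> 1" for a b :: real
  proof -
    have "sqrt a \<le> 1" "sqrt b \<le> 1" "0 \<le> sqrt a" "0 \<le> sqrt b" using that by simp_all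
    then have "\<bar>sqrt a + sqrt b\<bar> \<le> 2" by linarith
    then have "(sqrt a + sqrt b)\<^sup>2 \<le> 4" using power2_le_iff_abs_le[of 2 "sqrt a + sqrt b"] by simp
    moreover have "a - b = (sqrt a - sqrt b) * (sqrt a + sqrt b)"
      using that by (simp add: algebra_simps)
    ultimately show ?thesis
      using mult_left_mono[of "(sqrt a + sqrt b)\<^sup>2" 4 "(sqrt a - sqrt b)\<^sup>2"]
      by (simp add: power_mult_distrib)
  qed
  have "(sqrt p - sqrt q)\<^sup>2 = p + q - 2 * sqrt (p * q)"
    "(sqrt (1 - p) - sqrt (1 - q))\<^sup>2 = 2 - p - q - 2 * sqrt ((1 - p) * (1 - q))"
    using assms by (simp_all add: power2_diff real_sqrt_mult)
  then show ?thesis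
    using aux[of p q] aux[of "1 - p" "1 - q"] assms by (simp add: power2_commute)
qed

text \<open>The chi-square divergence of two Bernoulli laws. The left side is the factor by which
  the density \<open>m / n\<close> grows on average, with respect to \<mu>, from an interval to its
  children.\<close>

lemma chi_square_eq:
  fixes p q :: real
  assumes "0 < q" "q < 1"
  shows "p\<^sup>2 / q + (1 - p)\<^sup>2 / (1 - q) = 1 + (p - q)\<^sup>2 / (q * (1 - q))"
  using assms by (simp add: field_simps power2_eq_square)

lemma square_convex_comb_le:
  fixes p x y :: real
  assumes "0 \<le> p" "p \<le> 1"
  shows "(p * x + (1 - p) * y)\<^sup>2 \<le> p * x\<^sup>2 + (1 - p) * y\<^sup>2"
proof -
  have "p * x\<^sup>2 + (1 - p) * y\<^sup>2 - (p * x + (1 - p) * y)\<^sup>2 = p * (1 - p) * (x - y)\<^sup>2"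
    by (simp add: algebra_simps power2_eq_square)
  moreover have "0 \<le> p * (1 - p) * (x - y)\<^sup>2" using assms by simp
  ultimately show ?thesis by linarith
qed

lemma sum_lessThan_double:
  fixes f :: "nat \<Rightarrow> 'a::comm_monoid_add"
  shows "(\<Sum>i<2 * n. f i) = (\<Sum>j<n. f (2 * j) + f (Suc (2 * j)))"
  by (induction n) (auto simp: algebra_simps)

text \<open>The clause \<open>0 \<le> x\<close> is there because \<open>nat\<close> sends negative
  floors to 0, which would put negative points into the interval of index 0.\<close>

lemma dyadic_int_iff:
  "x \<in> dyadic_int k j \<longleftrightarrow> 0 \<le> x \<and> nat \<lfloor>x * 2 ^ k\<rfloor> = j"
proof -
  have "x \<in> dyadic_int k j \<longleftrightarrow> real j \<le> x * 2 ^ k \<and> x * 2 ^ k < real j + 1"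
    by (simp add: dyadic_int_def field_simps)
  also have "\<dots> \<longleftrightarrow> \<lfloor>x * 2 ^ k\<rfloor> = int j"
    by (simp add: floor_eq_iff)
  also have "\<dots> \<longleftrightarrow> 0 \<le> \<lfloor>x * 2 ^ k\<rfloor> \<and> nat \<lfloor>x * 2 ^ k\<rfloor> = j"
    by linarith
  also have "0 \<le> \<lfloor>x * 2 ^ k\<rfloor> \<longleftrightarrow> 0 \<le> x"
    by (metis mult_zero_left mult_le_cancel_right_pos zero_le_floor zero_less_numeral zero_less_power)
  finally show ?thesis .
qed

abbreviation dyadic_index :: "nat \<Rightarrow> real \<Rightarrow> nat" where
  "dyadic_index k x \<equiv> nat \<lfloor>x * 2 ^ k\<rfloor>"

lemma dyadic_index_less:
  assumes "0 \<le> x" "x < 1"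
  shows "dyadic_index k x < 2 ^ k"
proof -
  have "x * 2 ^ k < 2 ^ k" using assms by simp
  then have "\<lfloor>x * 2 ^ k\<rfloor> < 2 ^ k" by (simp add: floor_less_iff)
  then show ?thesis by (simp add: nat_less_iff assms)
qed

lemma dyadic_index_parent:
  assumes "0 \<le> x"
  shows "dyadic_index (Suc k) x div 2 = dyadic_index k x"
proof -
  have "\<lfloor>x * 2 ^ k\<rfloor> = \<lfloor>x * 2 ^ Suc k / real_of_int 2\<rfloor>" by simp
  also have "\<dots> = \<lfloor>x * 2 ^ Suc k\<rfloor> div 2" by (rule floor_divide_real_eq_div) simp
  finally show ?thesis by (simp add: nat_div_distrib assms)
qed

lemma dyadic_int_measurable [measurable]: "dyadic_int k j \<in> sets borel"
  by (simp add: dyadic_int_def)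

lemma dyadic_int_disjoint: "i \<noteq> j \<Longrightarrow> dyadic_int k i \<inter> dyadic_int k j = {}"
  by (auto simp: dyadic_int_iff)

lemma dyadic_int_children:
  "dyadic_int k j = dyadic_int (Suc k) (2 * j) \<union> dyadic_int (Suc k) (Suc (2 * j))"
  by (auto simp: dyadic_int_iff simp del: power_Suc dest!: dyadic_index_parent[of _ k])

lemma dyadic_int_0: "dyadic_int 0 0 = {0..<1}"
  by (simp add: dyadic_int_def)

lemma dyadic_int_ancestor:
  assumes "k \<le> l"
  shows "dyadic_int l i \<subseteq> dyadic_int k (i div 2 ^ (l - k))"
  using assms
proof (induction l arbitrary: i rule: dec_induct)
  case (step n)
  have "dyadic_int (Suc n) i \<subseteq> dyadic_int n (i div 2)"
    by (auto simp: dyadic_int_iff dyadic_index_parent simp del: power_Suc)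
  also have "\<dots> \<subseteq> dyadic_int k (i div 2 div 2 ^ (n - k))" by (rule step.IH)
  also have "i div 2 div 2 ^ (n - k) = i div 2 ^ (Suc n - k)"
    using step.hyps by (simp add: Suc_diff_le div_mult2_eq)
  finally show ?case .
qed simp

text \<open>Dyadic intervals are nested or disjoint, so the union is the disjoint union of its
  maximal members, and the inequality can be summed over those. It is used with \<mu> and \<nu> in
  either role: for the weak-type bound and for differentiation on null sets.\<close>

lemma emeasure_Union_dyadic_le:
  fixes m1 m2 :: "real measure" and P :: "nat \<Rightarrow> nat \<Rightarrow> bool"
  assumes [measurable_cong]: "sets m1 = sets borel" "sets m2 = sets borel"
    and le: "\<And>k j. P k j \<Longrightarrow> emeasure m1 (dyadic_int k j) \<le> c * emeasure m2 (dyadic_int k j)"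
  shows "emeasure m1 (\<Union>k. \<Union>j\<in>{j. P k j}. dyadic_int k j)
    \<le> c * emeasure m2 (\<Union>k. \<Union>j\<in>{j. P k j}. dyadic_int k j)"
proof -
  \<comment> \<open>\<open>Q\<close> selects the maximal intervals: \<open>j div 2 ^ (k - l)\<close>
    is the index of the ancestor in generation \<open>l\<close>.\<close>
  define Q where "Q = (\<lambda>k j. P k j \<and> (\<forall>l<k. \<not> P l (j div 2 ^ (k - l))))"
  define F where "F = (\<lambda>(k, j). dyadic_int k j)"
  have FQ: "F ` S \<subseteq> sets borel" for S by (auto simp: F_def)
  have eq: "(\<Union>k. \<Union>j\<in>{j. P k j}. dyadic_int k j) = (\<Union>p\<in>{(k, j). Q k j}. F p)"
  proof (intro set_eqI iffI)
    fix x assume "x \<in> (\<Union>k. \<Union>j\<in>{j. P k j}. dyadic_int k j)"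
    then obtain k j where kj: "P k j" "x \<in> dyadic_int k j" by auto
    define k0 where "k0 = (LEAST k. \<exists>j. P k j \<and> x \<in> dyadic_int k j)"
    obtain j0 where j0: "P k0 j0" "x \<in> dyadic_int k0 j0"
      using LeastI_ex[of "\<lambda>k. \<exists>j. P k j \<and> x \<in> dyadic_int k j"] kj unfolding k0_def by blast
    have "\<not> P l (j0 div 2 ^ (k0 - l))" if "l < k0" for l
      using not_less_Least[of l "\<lambda>k. \<exists>j. P k j \<and> x \<in> dyadic_int k j"] that
        dyadic_int_ancestor[of l k0 j0] j0(2) unfolding k0_def[symmetric] by auto
    then show "x \<in> (\<Union>p\<in>{(k, j). Q k j}. F p)"
      using j0 by (intro UN_I[of "(k0, j0)"]) (auto simp: Q_def F_def)
  qed (auto simp: Q_def F_def)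
  have disj: "disjoint_family_on F {(k, j). Q k j}"
  proof -
    have "k' = k \<and> j' = j" if "Q k j" "Q k' j'" "x \<in> dyadic_int k j" "x \<in> dyadic_int k' j'" for k j k' j' x
    proof -
      have no: "\<not> k < k'" if "Q k j" "Q k' j'" "x \<in> dyadic_int k j" "x \<in> dyadic_int k' j'" for k j k' j'
      proof
        assume "k < k'"
        then have "x \<in> dyadic_int k (j' div 2 ^ (k' - k))"
          using dyadic_int_ancestor[of k k' j'] that by auto
        then have "j' div 2 ^ (k' - k) = j" using that by (simp add: dyadic_int_iff)
        then show False using that \<open>k < k'\<close> by (auto simp: Q_def)
      qed
      have "k = k'" using no[OF that] no[OF that(2,1,4,3)] by simp
      then show ?thesis using that by (simp add: dyadic_int_iff)
    qed
    then show ?thesis unfolding disjoint_family_on_def F_def by fastforce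
  qed
  have cnt: "countable {(k, j). Q k j}" by simp
  have m1: "emeasure m1 (\<Union>p\<in>{(k, j). Q k j}. F p) = (\<integral>\<^sup>+p. emeasure m1 (F p) \<partial>count_space {(k, j). Q k j})"
    by (rule emeasure_UN_countable[OF _ cnt disj]) (auto simp: F_def assms(1))
  have m2: "emeasure m2 (\<Union>p\<in>{(k, j). Q k j}. F p) = (\<integral>\<^sup>+p. emeasure m2 (F p) \<partial>count_space {(k, j). Q k j})"
    by (rule emeasure_UN_countable[OF _ cnt disj]) (auto simp: F_def assms(2))
  have "emeasure m1 (\<Union>p\<in>{(k, j). Q k j}. F p)
      \<le> (\<integral>\<^sup>+p. c * emeasure m2 (F p) \<partial>count_space {(k, j). Q k j})"
    unfolding m1 by (rule nn_integral_mono) (auto simp: F_def Q_def le)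
  also have "\<dots> = c * emeasure m2 (\<Union>p\<in>{(k, j). Q k j}. F p)"
    unfolding m2 by (rule nn_integral_cmult) simp
  finally show ?thesis unfolding eq .
qed

section \<open>Blow-ups and averages over dyadic intervals\<close>

lemma integral_scale_measure:
  fixes f :: "'a \<Rightarrow> real"
  assumes "0 \<le> r" and f: "f \<in> borel_measurable M"
  shows "integral\<^sup>L (scale_measure (ennreal r) M) f = r * integral\<^sup>L M f"
proof -
  have "scale_measure (ennreal r) M = density M (\<lambda>_. ennreal r)"
    by (rule measure_eqI) (auto simp: emeasure_density_const)
  then show ?thesis using assms by (simp add: integral_density)
qed

lemma lebesgue_integral_blowup:
  fixes \<psi> :: "real \<Rightarrow> real"
  assumes [measurable_cong]: "sets m = sets borel" and "a < b" "measure m {a..<b} > 0"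
    and [measurable]: "\<psi> \<in> borel_measurable borel"
  shows "integral\<^sup>L (blowup m a b) \<psi>
    = (\<integral>x. indicator {a..<b} x * \<psi> ((x - a) / (b - a)) \<partial>m) / measure m {a..<b}"
proof -
  have [measurable]: "T_map a b \<in> borel_measurable borel" unfolding T_map_def by measurable
  have *: "indicator {a..<b} = (\<lambda>x. ennreal (indicator {a..<b} x :: real))"
    by (auto simp: fun_eq_iff indicator_def)
  have "emeasure m {a..<b} \<noteq> 0" using assms(3) by (auto simp: measure_def)
  then have "integral\<^sup>L (blowup m a b) \<psi> = integral\<^sup>L (scale_measure (ennreal (1 / measure m {a..<b}))
            (distr (density m (indicator {a..<b})) borel (T_map a b))) \<psi>" by (simp add: blowup_def)
  also have "\<dots> = (1 / measure m {a..<b}) * (integral\<^sup>L (distr (density m (indicator {a..<b})) borel (T_map a b)) \<psi>)"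
    using assms(3) by (subst integral_scale_measure) auto
  also have "integral\<^sup>L (distr (density m (indicator {a..<b})) borel (T_map a b)) \<psi>
     = (\<integral>x. \<psi> (T_map a b x) \<partial>density m (indicator {a..<b}))"
    by (subst integral_distr) auto
  also have "\<dots> = (\<integral>x. indicator {a..<b} x * \<psi> (T_map a b x) \<partial>m)"
    unfolding * by (subst integral_density) auto
  finally show ?thesis by (simp add: T_map_def)
qed

text \<open>Encodes a stopping time: an interval remains active as long as \<open>P\<close> has
  failed neither for it nor for any of its ancestors.\<close>

primrec along_ancestors :: "(nat \<Rightarrow> nat \<Rightarrow> bool) \<Rightarrow> nat \<Rightarrow> nat \<Rightarrow> bool" where
  "along_ancestors P 0 j \<longleftrightarrow> P 0 j"
| "along_ancestors P (Suc k) j \<longleftrightarrow> along_ancestors P k (j div 2) \<and> P (Suc k) j"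

lemma along_ancestorsD: "along_ancestors P k j \<Longrightarrow> P k j"
  by (cases k) auto

lemma along_ancestors_dyadic_index:
  assumes "0 \<le> x" "\<And>k. P k (dyadic_index k x)"
  shows "along_ancestors P k (dyadic_index k x)"
proof (induction k)
  case (Suc k)
  have "along_ancestors P k (dyadic_index (Suc k) x div 2)"
    using Suc dyadic_index_parent[OF assms(1)] by metis
  then show ?case using assms(2)[of "Suc k"] by simp
qed (use assms(2)[of 0] in simp)

text \<open>There is no rescaling to the unit interval, so one test function serves an interval and
  both of its children. On an interval of mass zero the value is 0.\<close>

definition dyadic_mean :: "real measure \<Rightarrow> nat \<Rightarrow> nat \<Rightarrow> (real \<Rightarrow> real) \<Rightarrow> real" where
  "dyadic_mean M k j \<phi> = (\<integral>x. indicator (dyadic_int k j) x * \<phi> x \<partial>M) / measure M (dyadic_int k j)"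

lemma lipschitz_on_real_iff:
  fixes \<phi> :: "real \<Rightarrow> real"
  shows "1-lipschitz_on UNIV \<phi> \<longleftrightarrow> (\<forall>x y. \<bar>\<phi> x - \<phi> y\<bar> \<le> \<bar>x - y\<bar>)"
  by (auto simp: lipschitz_on_def dist_real_def)

lemma lipschitz_on_borel_measurable:
  fixes \<phi> :: "real \<Rightarrow> real"
  assumes "1-lipschitz_on UNIV \<phi>"
  shows "\<phi> \<in> borel_measurable borel"
  using assms by (intro borel_measurable_continuous_onI lipschitz_on_continuous_on)

text \<open>A Lipschitz function on the line may be unbounded; closeness to a constant on the
  interval bounds the product with the indicator.\<close>

lemma indicator_mult_integrable:
  fixes \<phi> :: "real \<Rightarrow> real"
  assumes "finite_measure M" and sM [measurable_cong]: "sets M = sets borel"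
    and \<phi> [measurable]: "\<phi> \<in> borel_measurable borel"
    and le: "\<And>x. x \<in> dyadic_int k j \<Longrightarrow> \<bar>\<phi> x - c\<bar> \<le> h"
  shows "integrable M (\<lambda>x. indicator (dyadic_int k j) x * \<phi> x)"
proof -
  interpret finite_measure M by fact
  have "norm (indicator (dyadic_int k j) x * \<phi> x) \<le> \<bar>c\<bar> + \<bar>h\<bar>" for x
    using le[of x] by (auto simp: indicator_def)
  then show ?thesis
    by (intro integrable_const_bound[of _ "\<bar>c\<bar> + \<bar>h\<bar>"]) auto
qed

lemma integral_indicator_mult_near:
  fixes \<phi> :: "real \<Rightarrow> real"
  assumes "finite_measure M" and sM [measurable_cong]: "sets M = sets borel"
    and \<phi> [measurable]: "\<phi> \<in> borel_measurable borel"
    and le: "\<And>x. x \<in> dyadic_int k j \<Longrightarrow> \<bar>\<phi> x - c\<bar> \<le> h"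
  shows "\<bar>(\<integral>x. indicator (dyadic_int k j) x * \<phi> x \<partial>M) - c * measure M (dyadic_int k j)\<bar>
    \<le> h * measure M (dyadic_int k j)"
proof -
  interpret finite_measure M by fact
  let ?I = "dyadic_int k j"
  have int: "integrable M (\<lambda>x. indicator ?I x * \<phi> x)"
    using assms by (rule indicator_mult_integrable)
  have ind: "integrable M (\<lambda>x. indicator ?I x * b)" for b :: real
    by (intro integrable_mult_left integrable_real_indicator) (auto simp: sM less_top[symmetric])
  have cm: "(\<integral>x. indicator ?I x * b \<partial>M) = b * measure M ?I" for b :: real
    using sets_eq_imp_space_eq[OF sM] by simp
  have "\<bar>(\<integral>x. indicator ?I x * \<phi> x \<partial>M) - (\<integral>x. indicator ?I x * c \<partial>M)\<bar>
      = \<bar>\<integral>x. indicator ?I x * \<phi> x - indicator ?I x * c \<partial>M\<bar>"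
    by (simp only: Bochner_Integration.integral_diff[OF int ind])
  also have "\<dots> \<le> (\<integral>x. \<bar>indicator ?I x * \<phi> x - indicator ?I x * c\<bar> \<partial>M)"
    by (rule integral_abs_bound)
  also have "\<dots> \<le> (\<integral>x. indicator ?I x * h \<partial>M)"
    by (rule integral_mono) (use int ind le in \<open>auto simp: indicator_def\<close>)
  finally show ?thesis unfolding cm by simp
qed

lemma dyadic_mean_near:
  assumes "finite_measure M" "sets M = sets borel"
    and "\<phi> \<in> borel_measurable borel" "measure M (dyadic_int k j) > 0"
    and "\<And>x. x \<in> dyadic_int k j \<Longrightarrow> \<bar>\<phi> x - c\<bar> \<le> h"
  shows "\<bar>dyadic_mean M k j \<phi> - c\<bar> \<le> h"
  using integral_indicator_mult_near[OF assms(1-3,5)] assms(4)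
  unfolding dyadic_mean_def by (simp add: field_simps abs_le_iff)

text \<open>On a null interval the integral vanishes as well, by
  \<open>integral_indicator_mult_near\<close>. This covers children that \<mu> does not
  charge.\<close>

lemma dyadic_mean_mult_measure:
  assumes "finite_measure M" "sets M = sets borel"
    and "\<phi> \<in> borel_measurable borel"
    and "\<And>x. x \<in> dyadic_int k j \<Longrightarrow> \<bar>\<phi> x - c\<bar> \<le> h"
  shows "dyadic_mean M k j \<phi> * measure M (dyadic_int k j)
    = (\<integral>x. indicator (dyadic_int k j) x * \<phi> x \<partial>M)"
proof (cases "measure M (dyadic_int k j) = 0")
  case True
  then have "\<bar>\<integral>x. indicator (dyadic_int k j) x * \<phi> x \<partial>M\<bar> \<le> 0"
    using integral_indicator_mult_near[of M \<phi> k j c h] assms by simp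
  then show ?thesis using True by simp
qed (simp add: dyadic_mean_def)

lemma dyadic_mean_children:
  assumes "finite_measure M" "sets M = sets borel"
    and [measurable]: "\<phi> \<in> borel_measurable borel"
    and near: "\<And>x. x \<in> dyadic_int k j \<Longrightarrow> \<bar>\<phi> x - c\<bar> \<le> h"
  shows "dyadic_mean M k j \<phi> * measure M (dyadic_int k j)
    = dyadic_mean M (Suc k) (2 * j) \<phi> * measure M (dyadic_int (Suc k) (2 * j))
      + dyadic_mean M (Suc k) (Suc (2 * j)) \<phi> * measure M (dyadic_int (Suc k) (Suc (2 * j)))"
proof -
  let ?L = "dyadic_int (Suc k) (2 * j)" and ?R = "dyadic_int (Suc k) (Suc (2 * j))"
  have nearL: "x \<in> ?L \<Longrightarrow> \<bar>\<phi> x - c\<bar> \<le> h" and nearR: "x \<in> ?R \<Longrightarrow> \<bar>\<phi> x - c\<bar> \<le> h" for x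
    using near dyadic_int_children[of k j] by auto
  have "indicator (dyadic_int k j) x * \<phi> x = indicator ?L x * \<phi> x + indicator ?R x * \<phi> x" for x
    using dyadic_int_disjoint[of "2 * j" "Suc (2 * j)" "Suc k"]
    unfolding dyadic_int_children[of k j] by (auto simp: indicator_def)
  then have "(\<integral>x. indicator (dyadic_int k j) x * \<phi> x \<partial>M)
      = (\<integral>x. indicator ?L x * \<phi> x \<partial>M) + (\<integral>x. indicator ?R x * \<phi> x \<partial>M)"
    using indicator_mult_integrable[OF assms(1-3) nearL] indicator_mult_integrable[OF assms(1-3) nearR]
    by simp
  then show ?thesis
    using dyadic_mean_mult_measure[OF assms(1-3) near] dyadic_mean_mult_measure[OF assms(1-3) nearL]
      dyadic_mean_mult_measure[OF assms(1-3) nearR] by simp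
qed

lemma dyadic_int_dist:
  assumes "x \<in> dyadic_int k j" "y \<in> {real j / 2 ^ k..(real j + 1) / 2 ^ k}"
  shows "\<bar>x - y\<bar> \<le> 1 / 2 ^ k"
  using assms by (auto simp: dyadic_int_def add_divide_distrib)

definition dyadic_blowup :: "real measure \<Rightarrow> nat \<Rightarrow> nat \<Rightarrow> real measure" where
  "dyadic_blowup M k j = blowup M (real j / 2 ^ k) ((real j + 1) / 2 ^ k)"

lemma lebesgue_integral_dyadic_blowup:
  fixes \<psi> :: "real \<Rightarrow> real"
  assumes "sets M = sets borel" "measure M (dyadic_int k j) > 0" "\<psi> \<in> borel_measurable borel"
  shows "integral\<^sup>L (dyadic_blowup M k j) \<psi> = dyadic_mean M k j (\<lambda>x. \<psi> (x * 2 ^ k - j))"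
proof -
  have "real j / 2 ^ k < (real j + 1) / 2 ^ k" by (simp add: divide_strict_right_mono)
  moreover have "(x - real j / 2 ^ k) / ((real j + 1) / 2 ^ k - real j / 2 ^ k) = x * 2 ^ k - j" for x
    by (simp add: field_simps)
  ultimately show ?thesis
    using lebesgue_integral_blowup[OF assms(1), of "real j / 2 ^ k" "(real j + 1) / 2 ^ k" \<psi>] assms
    by (simp add: dyadic_mean_def dyadic_blowup_def dyadic_int_def)
qed

section \<open>Masses and Hellinger affinities of a doubling pair\<close>

locale dyadic_pair =
  fixes \<mu> \<nu> :: "real measure" and C :: real
  assumes sets_mu [measurable_cong]: "sets \<mu> = sets borel" and prob_mu: "prob_space \<mu>"
    and mu_unit: "emeasure \<mu> {0..<1} = 1"
    and sets_nu [measurable_cong]: "sets \<nu> = sets borel" and prob_nu: "prob_space \<nu>"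
    and nu_unit: "emeasure \<nu> {0..<1} = 1"
    and C_ge_1: "C \<ge> 1"
    and doubling: "\<And>k j. j < 2 ^ Suc k \<Longrightarrow>
      measure \<nu> (dyadic_int k (j div 2)) \<le> C * measure \<nu> (dyadic_int (Suc k) j)"
begin

sublocale mu: prob_space \<mu> by (rule prob_mu)
sublocale nu: prob_space \<nu> by (rule prob_nu)

definition m :: "nat \<Rightarrow> nat \<Rightarrow> real" where "m k j = measure \<mu> (dyadic_int k j)"
definition n :: "nat \<Rightarrow> nat \<Rightarrow> real" where "n k j = measure \<nu> (dyadic_int k j)"

definition \<Delta> :: "nat \<Rightarrow> nat \<Rightarrow> real" where
  "\<Delta> k j = m (Suc k) (2 * j) / m k j - n (Suc k) (2 * j) / n k j"

lemma m_nonneg [simp]: "0 \<le> m k j" by (simp add: m_def)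
lemma n_nonneg [simp]: "0 \<le> n k j" by (simp add: n_def)

lemma m_root: "m 0 0 = 1" by (simp add: m_def dyadic_int_0 measure_def mu_unit)
lemma n_root: "n 0 0 = 1" by (simp add: n_def dyadic_int_0 measure_def nu_unit)

lemma m_children: "m k j = m (Suc k) (2 * j) + m (Suc k) (Suc (2 * j))"
  unfolding m_def dyadic_int_children[of k j]
  by (rule mu.finite_measure_Union) (auto simp: sets_mu dyadic_int_disjoint simp del: power_Suc)

lemma n_children: "n k j = n (Suc k) (2 * j) + n (Suc k) (Suc (2 * j))"
  unfolding n_def dyadic_int_children[of k j]
  by (rule nu.finite_measure_Union) (auto simp: sets_nu dyadic_int_disjoint simp del: power_Suc)

lemma n_parent_le: "j < 2 ^ Suc k \<Longrightarrow> n k (j div 2) \<le> C * n (Suc k) j"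
  using doubling[of j k] by (simp add: n_def)

lemma n_pos: "j < 2 ^ k \<Longrightarrow> 0 < n k j"
proof (induction k arbitrary: j)
  case (Suc k)
  have "0 < n k (j div 2)" using Suc by simp
  also have "\<dots> \<le> C * n (Suc k) j" by (rule n_parent_le[OF Suc.prems])
  finally show ?case using C_ge_1 by (simp add: zero_less_mult_iff)
qed (simp add: n_root)

lemma sum_m: "(\<Sum>j<2 ^ k. m k j) = 1"
proof (induction k)
  case (Suc k)
  have "(\<Sum>j<2 ^ Suc k. m (Suc k) j) = (\<Sum>j<2 ^ k. m k j)"
    unfolding power_Suc sum_lessThan_double by (intro sum.cong refl m_children[symmetric])
  then show ?case using Suc by simp
qed (simp add: m_root)

text \<open>In terms of the left proportions \<open>p\<close> and \<open>q\<close>, the affinity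
  lost in passing to the children is \<open>sqrt (m k j * n k j)\<close> times the expression that
  \<open>hellinger_ge_square_diff\<close> bounds from below.\<close>

lemma hellinger_step:
  "j < 2 ^ k \<Longrightarrow> sqrt (m k j * n k j) * (\<Delta> k j)\<^sup>2 / 4
    \<le> sqrt (m k j * n k j) - sqrt (m (Suc k) (2 * j) * n (Suc k) (2 * j))
      - sqrt (m (Suc k) (Suc (2 * j)) * n (Suc k) (Suc (2 * j)))"
proof (cases "m k j = 0")
  case True
  then have "m (Suc k) (2 * j) = 0" "m (Suc k) (Suc (2 * j)) = 0"
    using m_children[of k j] m_nonneg[of "Suc k" "2 * j"] m_nonneg[of "Suc k" "Suc (2 * j)"] by linarith+
  then show ?thesis using True by simp
next
  case False
  assume j: "j < 2 ^ k"
  define p q where "p = m (Suc k) (2 * j) / m k j" and "q = n (Suc k) (2 * j) / n k j"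
  have pos: "0 < m k j" "0 < n k j" using False n_pos[OF j] m_nonneg[of k j] by linarith+
  have p: "m (Suc k) (2 * j) = p * m k j" "m (Suc k) (Suc (2 * j)) = (1 - p) * m k j"
    using pos m_children[of k j] by (simp_all add: p_def field_simps)
  have q: "n (Suc k) (2 * j) = q * n k j" "n (Suc k) (Suc (2 * j)) = (1 - q) * n k j"
    using pos n_children[of k j] by (simp_all add: q_def field_simps)
  have pq: "0 \<le> p" "p \<le> 1" "0 \<le> q" "q \<le> 1"
    using pos m_children[of k j] n_children[of k j] by (simp_all add: p_def q_def)
  have "sqrt (m k j * n k j) * ((p - q)\<^sup>2 / 4)
      \<le> sqrt (m k j * n k j) * (1 - sqrt (p * q) - sqrt ((1 - p) * (1 - q)))"
    by (intro mult_left_mono hellinger_ge_square_diff pq) simp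
  moreover have "sqrt (p * m k j * (q * n k j)) = sqrt (m k j * n k j) * sqrt (p * q)"
    "sqrt ((1 - p) * m k j * ((1 - q) * n k j)) = sqrt (m k j * n k j) * sqrt ((1 - p) * (1 - q))"
    by (simp_all add: real_sqrt_mult)
  moreover have "\<Delta> k j = p - q" by (simp add: \<Delta>_def p_def q_def)
  ultimately show ?thesis
    unfolding p q by (simp add: right_diff_distrib)
qed

text \<open>The affinity \<open>H\<close> starts at 1 and stays nonnegative, so the total loss is at
  most 1; the 4 is the denominator in \<open>hellinger_step\<close>.\<close>

lemma hellinger_sum: "(\<Sum>k<N. \<Sum>j<2 ^ k. sqrt (m k j * n k j) * (\<Delta> k j)\<^sup>2) \<le> 4"
proof -
  define H where "H = (\<lambda>k. \<Sum>j<2 ^ k. sqrt (m k j * n k j))"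
  have step: "(\<Sum>j<2 ^ k. sqrt (m k j * n k j) * (\<Delta> k j)\<^sup>2) \<le> 4 * (H k - H (Suc k))" for k
  proof -
    have "(\<Sum>j<2 ^ k. sqrt (m k j * n k j) * (\<Delta> k j)\<^sup>2 / 4)
        \<le> (\<Sum>j<2 ^ k. sqrt (m k j * n k j) - sqrt (m (Suc k) (2 * j) * n (Suc k) (2 * j))
      - sqrt (m (Suc k) (Suc (2 * j)) * n (Suc k) (Suc (2 * j))))"
      by (intro sum_mono hellinger_step) simp
    also have "\<dots> = H k - H (Suc k)"
      by (simp add: H_def sum_lessThan_double sum_subtractf sum.distrib)
    finally show ?thesis by (simp add: sum_divide_distrib[symmetric])
  qed
  have "(\<Sum>k<N. \<Sum>j<2 ^ k. sqrt (m k j * n k j) * (\<Delta> k j)\<^sup>2) \<le> (\<Sum>k<N. 4 * (H k - H (Suc k)))"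
    by (intro sum_mono step)
  also have "\<dots> = 4 * (H 0 - H N)"
    unfolding sum_distrib_left[symmetric] by (simp add: sum_lessThan_telescope')
  also have "\<dots> \<le> 4" by (simp add: H_def m_root n_root sum_nonneg)
  finally show ?thesis .
qed

end

section \<open>Finiteness where the density is bounded\<close>

lemma lipschitz_near:
  fixes \<phi> :: "real \<Rightarrow> real"
  assumes "1-lipschitz_on UNIV \<phi>" "x \<in> dyadic_int k j" "y \<in> {real j / 2 ^ k..(real j + 1) / 2 ^ k}"
  shows "\<bar>\<phi> x - \<phi> y\<bar> \<le> 1 / 2 ^ k"
  using assms(1) dyadic_int_dist[OF assms(2,3)] unfolding lipschitz_on_real_iff
  by (meson order_trans)

context dyadic_pair
begin

text \<open>Test functions carry no support condition, so they remain admissible on the children,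
  which makes the recursion \<open>W_rec\<close> possible. The factor \<open>2 ^ k\<close>
  normalizes the interval to unit length.\<close>

definition W :: "nat \<Rightarrow> nat \<Rightarrow> real" where
  "W k j = 2 ^ k * Sup {\<bar>dyadic_mean \<mu> k j \<phi> - dyadic_mean \<nu> k j \<phi>\<bar> | \<phi>. 1-lipschitz_on UNIV \<phi>}"

lemma dyadic_mean_mu_near:
  assumes "0 < m k j" "1-lipschitz_on UNIV \<phi>" "y \<in> {real j / 2 ^ k..(real j + 1) / 2 ^ k}"
  shows "\<bar>dyadic_mean \<mu> k j \<phi> - \<phi> y\<bar> \<le> 1 / 2 ^ k"
  using assms
  by (intro dyadic_mean_near lipschitz_near lipschitz_on_borel_measurable)
    (auto simp: sets_mu m_def mu.finite_measure_axioms)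

lemma dyadic_mean_nu_near:
  assumes "j < 2 ^ k" "1-lipschitz_on UNIV \<phi>" "y \<in> {real j / 2 ^ k..(real j + 1) / 2 ^ k}"
  shows "\<bar>dyadic_mean \<nu> k j \<phi> - \<phi> y\<bar> \<le> 1 / 2 ^ k"
  using assms n_pos[OF assms(1)]
  by (intro dyadic_mean_near lipschitz_near lipschitz_on_borel_measurable)
    (auto simp: sets_nu n_def nu.finite_measure_axioms)

text \<open>Both averages lie within \<open>1 / 2 ^ k\<close> of the value at the left endpoint.
  This makes the supremum in \<open>W\<close> one over a bounded set.\<close>

lemma dyadic_mean_diff_le:
  assumes "0 < m k j" "j < 2 ^ k" "1-lipschitz_on UNIV \<phi>"
  shows "\<bar>dyadic_mean \<mu> k j \<phi> - dyadic_mean \<nu> k j \<phi>\<bar> \<le> 2 / 2 ^ k"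
proof -
  have y: "real j / 2 ^ k \<in> {real j / 2 ^ k..(real j + 1) / 2 ^ k}" by (simp add: divide_right_mono)
  show ?thesis
    using dyadic_mean_mu_near[OF assms(1,3) y] dyadic_mean_nu_near[OF assms(2,3) y] by linarith
qed

lemma lipschitz_on_zero: "1-lipschitz_on UNIV (\<lambda>_ :: real. 0 :: real)"
  by (simp add: lipschitz_on_real_iff)

lemma W_ge:
  assumes "0 < m k j" "j < 2 ^ k" "1-lipschitz_on UNIV \<phi>"
  shows "\<bar>dyadic_mean \<mu> k j \<phi> - dyadic_mean \<nu> k j \<phi>\<bar> * 2 ^ k \<le> W k j"
proof -
  have "\<bar>dyadic_mean \<mu> k j \<phi> - dyadic_mean \<nu> k j \<phi>\<bar>
    \<le> Sup {\<bar>dyadic_mean \<mu> k j \<phi> - dyadic_mean \<nu> k j \<phi>\<bar> | \<phi>. 1-lipschitz_on UNIV \<phi>}"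
    using dyadic_mean_diff_le[OF assms(1,2)] assms(3)
    by (intro cSup_upper) (auto simp: bdd_above_def)
  then show ?thesis by (simp add: W_def mult.commute)
qed

lemma W_le:
  assumes "\<And>\<phi>. 1-lipschitz_on UNIV \<phi> \<Longrightarrow>
    \<bar>dyadic_mean \<mu> k j \<phi> - dyadic_mean \<nu> k j \<phi>\<bar> * 2 ^ k \<le> B"
  shows "W k j \<le> B"
proof -
  have "Sup {\<bar>dyadic_mean \<mu> k j \<phi> - dyadic_mean \<nu> k j \<phi>\<bar> | \<phi>. 1-lipschitz_on UNIV \<phi>} \<le> B / 2 ^ k"
    using assms lipschitz_on_zero by (intro cSup_least) (auto simp: field_simps)
  then show ?thesis by (simp add: W_def field_simps)
qed

lemma W_nonneg: "0 < m k j \<Longrightarrow> j < 2 ^ k \<Longrightarrow> 0 \<le> W k j"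
  using W_ge[OF _ _ lipschitz_on_zero, of k j] by (simp add: dyadic_mean_def)

lemma W_le_2: "0 < m k j \<Longrightarrow> j < 2 ^ k \<Longrightarrow> W k j \<le> 2"
  using dyadic_mean_diff_le[of k j] by (intro W_le) (auto simp: field_simps)

text \<open>The difference of the averages splits into the differences on the two children, weighted
  by \<open>p\<close> and \<open>1 - p\<close>, plus \<open>\<Delta> k j\<close> times the
  difference of the two \<nu>-averages over the children. The factor 1/2 comes from the
  normalization: a child has half the length.\<close>

lemma W_rec:
  assumes pos: "0 < m k j" and j: "j < 2 ^ k"
  defines "p \<equiv> m (Suc k) (2 * j) / m k j"
  shows "W k j \<le> \<bar>\<Delta> k j\<bar> + (p * W (Suc k) (2 * j) + (1 - p) * W (Suc k) (Suc (2 * j))) / 2"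
proof (rule W_le)
  fix \<phi> :: "real \<Rightarrow> real" assume \<phi>: "1-lipschitz_on UNIV \<phi>"
  let ?A = "dyadic_mean \<mu>" and ?B = "dyadic_mean \<nu>"
  define q where "q = n (Suc k) (2 * j) / n k j"
  have npos: "0 < n k j" by (rule n_pos[OF j])
  have p: "m (Suc k) (2 * j) = p * m k j" "m (Suc k) (Suc (2 * j)) = (1 - p) * m k j"
    using pos m_children[of k j] by (simp_all add: p_def field_simps)
  have q: "n (Suc k) (2 * j) = q * n k j" "n (Suc k) (Suc (2 * j)) = (1 - q) * n k j"
    using npos n_children[of k j] by (simp_all add: q_def field_simps)
  have near: "x \<in> dyadic_int k j \<Longrightarrow> \<bar>\<phi> x - \<phi> (real j / 2 ^ k)\<bar> \<le> 1 / 2 ^ k" for x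
    by (intro lipschitz_near[OF \<phi>]) (auto intro: divide_right_mono)
  have meas: "\<phi> \<in> borel_measurable borel" by (rule lipschitz_on_borel_measurable[OF \<phi>])
  have A: "?A k j \<phi> = p * ?A (Suc k) (2 * j) \<phi> + (1 - p) * ?A (Suc k) (Suc (2 * j)) \<phi>"
  proof -
    have "?A k j \<phi> * m k j = (p * ?A (Suc k) (2 * j) \<phi> + (1 - p) * ?A (Suc k) (Suc (2 * j)) \<phi>) * m k j"
      using dyadic_mean_children[OF mu.finite_measure_axioms sets_mu meas near, of k j]
      unfolding m_def[symmetric] p by (simp only: algebra_simps)
    then show ?thesis using pos by simp
  qed
  have B: "?B k j \<phi> = q * ?B (Suc k) (2 * j) \<phi> + (1 - q) * ?B (Suc k) (Suc (2 * j)) \<phi>"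
  proof -
    have "?B k j \<phi> * n k j = (q * ?B (Suc k) (2 * j) \<phi> + (1 - q) * ?B (Suc k) (Suc (2 * j)) \<phi>) * n k j"
      using dyadic_mean_children[OF nu.finite_measure_axioms sets_nu meas near, of k j]
      unfolding n_def[symmetric] q by (simp only: algebra_simps)
    then show ?thesis using npos by simp
  qed
  have i: "2 * j < 2 ^ Suc k" "Suc (2 * j) < 2 ^ Suc k" using j by auto
  \<comment> \<open>With \<open>r = 0\<close> the child has no mass and both sides vanish, so
    \<open>W_ge\<close> is applied only to charged children.\<close>
  have weighted: "\<bar>r * (?A (Suc k) i \<phi> - ?B (Suc k) i \<phi>)\<bar> * 2 ^ k \<le> r * W (Suc k) i / 2"
    if "i < 2 ^ Suc k" "0 \<le> r" "m (Suc k) i = r * m k j" for r i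
  proof (cases "r = 0")
    case False
    then have "0 < m (Suc k) i" using that pos by simp
    from W_ge[OF this that(1) \<phi>]
    have "r * (\<bar>?A (Suc k) i \<phi> - ?B (Suc k) i \<phi>\<bar> * 2 ^ Suc k) \<le> r * W (Suc k) i"
      using that(2) by (rule mult_left_mono)
    then show ?thesis using that(2) by (simp add: abs_mult mult_ac)
  qed simp
  have p01: "0 \<le> p" "0 \<le> 1 - p" using pos m_children[of k j] by (simp_all add: p_def)
  have mid: "\<bar>?B (Suc k) (2 * j) \<phi> - ?B (Suc k) (Suc (2 * j)) \<phi>\<bar> * 2 ^ k \<le> 1"
  proof -
    \<comment> \<open>\<open>y\<close> is the midpoint of the interval, an endpoint of both
      children, so each child average is within half the length of \<open>\<phi> y\<close>.\<close>
    define y where "y = (2 * real j + 1) / 2 ^ Suc k"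
    have "\<bar>?B (Suc k) (2 * j) \<phi> - \<phi> y\<bar> \<le> 1 / 2 ^ Suc k"
      "\<bar>?B (Suc k) (Suc (2 * j)) \<phi> - \<phi> y\<bar> \<le> 1 / 2 ^ Suc k"
      by (rule dyadic_mean_nu_near[OF _ \<phi>]; use i in \<open>simp add: y_def field_simps\<close>)+
    then have "\<bar>?B (Suc k) (2 * j) \<phi> - ?B (Suc k) (Suc (2 * j)) \<phi>\<bar> \<le> 1 / 2 ^ Suc k + 1 / 2 ^ Suc k"
      by linarith
    then show ?thesis by (simp add: field_simps)
  qed
  have D: "\<Delta> k j = p - q" by (simp add: \<Delta>_def p_def q_def)
  have "?A k j \<phi> - ?B k j \<phi> = p * (?A (Suc k) (2 * j) \<phi> - ?B (Suc k) (2 * j) \<phi>)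
      + (1 - p) * (?A (Suc k) (Suc (2 * j)) \<phi> - ?B (Suc k) (Suc (2 * j)) \<phi>)
      + \<Delta> k j * (?B (Suc k) (2 * j) \<phi> - ?B (Suc k) (Suc (2 * j)) \<phi>)"
    unfolding A B D by (simp add: algebra_simps)
  also have "\<bar>\<dots>\<bar> \<le> \<bar>p * (?A (Suc k) (2 * j) \<phi> - ?B (Suc k) (2 * j) \<phi>)\<bar>
      + \<bar>(1 - p) * (?A (Suc k) (Suc (2 * j)) \<phi> - ?B (Suc k) (Suc (2 * j)) \<phi>)\<bar>
      + \<bar>\<Delta> k j\<bar> * \<bar>?B (Suc k) (2 * j) \<phi> - ?B (Suc k) (Suc (2 * j)) \<phi>\<bar>"
    by (simp only: abs_mult[symmetric])
  finally have "\<bar>?A k j \<phi> - ?B k j \<phi>\<bar> * 2 ^ k \<le> (\<bar>p * (?A (Suc k) (2 * j) \<phi> - ?B (Suc k) (2 * j) \<phi>)\<bar>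
      + \<bar>(1 - p) * (?A (Suc k) (Suc (2 * j)) \<phi> - ?B (Suc k) (Suc (2 * j)) \<phi>)\<bar>
      + \<bar>\<Delta> k j\<bar> * \<bar>?B (Suc k) (2 * j) \<phi> - ?B (Suc k) (Suc (2 * j)) \<phi>\<bar>) * 2 ^ k"
    by (rule mult_right_mono) simp
  also have "\<dots> \<le> p * W (Suc k) (2 * j) / 2 + (1 - p) * W (Suc k) (Suc (2 * j)) / 2 + \<bar>\<Delta> k j\<bar> * 1"
    unfolding distrib_right mult.assoc[of "\<bar>\<Delta> k j\<bar>"]
    by (intro add_mono weighted mult_left_mono mid p i p01 abs_ge_zero)
  finally show "\<bar>?A k j \<phi> - ?B k j \<phi>\<bar> * 2 ^ k
      \<le> \<bar>\<Delta> k j\<bar> + (p * W (Suc k) (2 * j) + (1 - p) * W (Suc k) (Suc (2 * j))) / 2"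
    by argo
qed

text \<open>Squaring \<open>W_rec\<close> by
  \<open>(d + t)\<^sup>2 \<le> 2 * d\<^sup>2 + 2 * t\<^sup>2\<close> and convexity costs a factor 2,
  but the squared 1/2 still leaves a contraction by 1/2.\<close>

lemma W_square_rec:
  assumes j: "j < 2 ^ k"
  shows "m k j * (W k j)\<^sup>2 \<le> 2 * (m k j * (\<Delta> k j)\<^sup>2)
    + (m (Suc k) (2 * j) * (W (Suc k) (2 * j))\<^sup>2 + m (Suc k) (Suc (2 * j)) * (W (Suc k) (Suc (2 * j)))\<^sup>2) / 2"
proof (cases "m k j = 0")
  case True
  then show ?thesis by simp
next
  case False
  then have pos: "0 < m k j" using m_nonneg[of k j] by linarith
  define p y z where "p = m (Suc k) (2 * j) / m k j" and "y = W (Suc k) (2 * j)"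
    and "z = W (Suc k) (Suc (2 * j))"
  have p: "m (Suc k) (2 * j) = p * m k j" "m (Suc k) (Suc (2 * j)) = (1 - p) * m k j"
    using pos m_children[of k j] by (simp_all add: p_def field_simps)
  have p01: "0 \<le> p" "p \<le> 1" using pos m_children[of k j] by (simp_all add: p_def)
  define d t where "d = \<bar>\<Delta> k j\<bar>" and "t = (p * y + (1 - p) * z) / 2"
  have "W k j \<le> d + t"
    using W_rec[OF pos j] by (simp add: p_def y_def z_def d_def t_def)
  then have "(W k j)\<^sup>2 \<le> (d + t)\<^sup>2"
    using W_nonneg[OF pos j] by (rule power_mono)
  also have "\<dots> \<le> 2 * d\<^sup>2 + 2 * t\<^sup>2"
    using zero_le_power2[of "d - t"] by (simp add: power2_sum power2_diff)
  also have "2 * t\<^sup>2 \<le> (p * y\<^sup>2 + (1 - p) * z\<^sup>2) / 2"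
    using square_convex_comb_le[OF p01, of y z] by (simp add: t_def power_divide)
  finally have "m k j * (W k j)\<^sup>2 \<le> m k j * (2 * d\<^sup>2 + (p * y\<^sup>2 + (1 - p) * z\<^sup>2) / 2)"
    using pos by simp
  then show ?thesis
    unfolding p y_def[symmetric] z_def[symmetric] by (simp add: d_def algebra_simps add_divide_distrib)
qed

lemma m_W_square_le: "j < 2 ^ k \<Longrightarrow> m k j * (W k j)\<^sup>2 \<le> 4 * m k j"
proof (cases "m k j = 0")
  case False
  assume j: "j < 2 ^ k"
  have pos: "0 < m k j" using False m_nonneg[of k j] by linarith
  have "(W k j)\<^sup>2 \<le> 2\<^sup>2" using W_le_2[OF pos j] W_nonneg[OF pos j] by (intro power_mono) auto
  then show ?thesis using pos by simp
qed simp

text \<open>The contraction in \<open>W_square_rec\<close> allows half of the sum to be absorbed.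
  What remains is the stopped sum of \<open>m * \<Delta>\<^sup>2\<close>, controlled by Hellinger,
  and the mass lost by stopping, which telescopes.\<close>

lemma stopped_W_sum:
  fixes M :: real
  assumes "0 \<le> M"
  defines "u \<equiv> \<lambda>k j. of_bool (along_ancestors (\<lambda>k j. m k j \<le> M * n k j) k j) :: real"
  shows "(\<Sum>k<N. \<Sum>j<2 ^ k. u k j * (m k j * (W k j)\<^sup>2)) \<le> 16 * sqrt M + 8"
proof -
  define A V D where "A = (\<lambda>k. \<Sum>j<2 ^ k. u k j * (m k j * (W k j)\<^sup>2))"
    and "V = (\<lambda>k. \<Sum>j<2 ^ k. u k j * m k j)"
    and "D = (\<lambda>k. \<Sum>j<2 ^ k. u k j * (m k j * (\<Delta> k j)\<^sup>2))"
  have u01: "0 \<le> u k j" "u k j \<le> 1" for k j by (simp_all add: u_def)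
  have u_Suc: "u (Suc k) i \<le> u k (i div 2)" for k i by (simp add: u_def)
  have step: "A k \<le> 2 * D k + A (Suc k) / 2 + 2 * (V k - V (Suc k))" for k
  proof -
    let ?g = "\<lambda>i. m (Suc k) i * (W (Suc k) i)\<^sup>2"
    have "A k \<le> (\<Sum>j<2 ^ k. u k j * (2 * (m k j * (\<Delta> k j)\<^sup>2) + (?g (2 * j) + ?g (Suc (2 * j))) / 2))"
      unfolding A_def by (intro sum_mono mult_left_mono W_square_rec) (auto simp: u01)
    also have "\<dots> = 2 * D k + (\<Sum>j<2 ^ k. u k j * ?g (2 * j) + u k j * ?g (Suc (2 * j))) / 2"
      by (simp add: D_def distrib_left sum.distrib sum_distrib_left sum_divide_distrib mult_ac add_divide_distrib)
    finally have le: "A k \<le> 2 * D k + (\<Sum>j<2 ^ k. u k j * ?g (2 * j) + u k j * ?g (Suc (2 * j))) / 2" .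
    have "(\<Sum>j<2 ^ k. u k j * ?g (2 * j) + u k j * ?g (Suc (2 * j))) = (\<Sum>i<2 ^ Suc k. u k (i div 2) * ?g i)"
      unfolding power_Suc sum_lessThan_double by simp
    \<comment> \<open>The weight \<open>u k (i div 2) - u (Suc k) i\<close> is 1 exactly where
      stopping occurs at the child \<open>i\<close>; there \<open>W \<le> 2\<close> gives the bound
      \<open>4 * m (Suc k) i\<close>. These masses add up to \<open>V k - V (Suc k)\<close>.\<close>
    also have "\<dots> \<le> (\<Sum>i<2 ^ Suc k. u (Suc k) i * ?g i + 4 * ((u k (i div 2) - u (Suc k) i) * m (Suc k) i))"
    proof (rule sum_mono)
      fix i :: nat assume i: "i \<in> {..<2 ^ Suc k}"
      have "(u k (i div 2) - u (Suc k) i) * ?g i \<le> (u k (i div 2) - u (Suc k) i) * (4 * m (Suc k) i)"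
        by (intro mult_left_mono m_W_square_le) (use i u_Suc in auto)
      then show "u k (i div 2) * ?g i \<le> u (Suc k) i * ?g i + 4 * ((u k (i div 2) - u (Suc k) i) * m (Suc k) i)"
        by (simp add: algebra_simps)
    qed
    also have "\<dots> = A (Suc k) + 4 * ((\<Sum>i<2 ^ Suc k. u k (i div 2) * m (Suc k) i) - V (Suc k))"
      by (simp add: A_def V_def sum.distrib sum_distrib_left sum_subtractf left_diff_distrib right_diff_distrib)
    also have "(\<Sum>i<2 ^ Suc k. u k (i div 2) * m (Suc k) i) = V k"
      unfolding power_Suc sum_lessThan_double V_def
      by (intro sum.cong refl) (simp add: m_children[of k] distrib_left)
    finally show ?thesis using le by argo
  qed
  \<comment> \<open>On an active interval \<open>m \<le> M * n\<close>, hence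
    \<open>m \<le> sqrt M * sqrt (m * n)\<close>, which is the weight in
    \<open>hellinger_sum\<close>.\<close>
  have D: "(\<Sum>k<N. D k) \<le> 4 * sqrt M" for N
  proof -
    have "u k j * (m k j * (\<Delta> k j)\<^sup>2) \<le> sqrt M * (sqrt (m k j * n k j) * (\<Delta> k j)\<^sup>2)" for k j
    proof (cases "u k j = 0")
      case False
      then have le: "m k j \<le> M * n k j" by (auto simp: u_def dest: along_ancestorsD)
      have "m k j = sqrt (m k j * m k j)" by simp
      also have "\<dots> \<le> sqrt (m k j * (M * n k j))"
        using le by (intro real_sqrt_le_mono mult_left_mono) auto
      finally have "m k j \<le> sqrt M * sqrt (m k j * n k j)" by (simp add: real_sqrt_mult mult_ac)
      then have "m k j * (\<Delta> k j)\<^sup>2 \<le> sqrt M * sqrt (m k j * n k j) * (\<Delta> k j)\<^sup>2"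
        by (rule mult_right_mono) simp
      moreover have "u k j = 1" using False by (simp add: u_def)
      ultimately show ?thesis by (simp add: mult.assoc)
    qed (use assms in simp)
    then have "(\<Sum>k<N. D k) \<le> sqrt M * (\<Sum>k<N. \<Sum>j<2 ^ k. sqrt (m k j * n k j) * (\<Delta> k j)\<^sup>2)"
      unfolding D_def sum_distrib_left by (intro sum_mono)
    also have "\<dots> \<le> sqrt M * 4" using assms by (intro mult_left_mono hellinger_sum) simp
    finally show ?thesis by simp
  qed
  have V: "0 \<le> V k" "V k \<le> 1" for k
  proof -
    have "V k \<le> (\<Sum>j<2 ^ k. 1 * m k j)" unfolding V_def by (intro sum_mono mult_right_mono u01 m_nonneg)
    then show "V k \<le> 1" by (simp add: sum_m)
  qed (simp add: V_def sum_nonneg u01)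
  have A: "0 \<le> A k" "A k \<le> 4" for k
  proof -
    have "A k \<le> (\<Sum>j<2 ^ k. 1 * (4 * m k j))"
      unfolding A_def by (intro sum_mono mult_mono u01 m_W_square_le) auto
    then show "A k \<le> 4" by (simp add: sum_m sum_distrib_left[symmetric])
  qed (simp add: A_def sum_nonneg u01)
  \<comment> \<open>Shifting the index of \<open>A (Suc k)\<close> leaves
    \<open>(A N - A 0) / 2\<close>. The terms are at most \<open>8 * sqrt M\<close>, 2 and 2 besides
    half of the sum itself; absorbing that half doubles the constants.\<close>
  have "(\<Sum>k<N. A k) \<le> 2 * (\<Sum>k<N. D k) + (\<Sum>k<N. A k) / 2 + (A N - A 0) / 2 + 2 * (V 0 - V N)"
  proof (induction N)
    case (Suc N)
    then show ?case using step[of N] by (simp add: field_simps)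
  qed simp
  then have "(\<Sum>k<N. A k) \<le> 16 * sqrt M + 8"
    using D[of N] A[of 0] A[of N] V[of 0] V[of N] by argo
  then show ?thesis unfolding A_def .
qed

end

section \<open>From \<open>W\<close> to \<alpha>, and the stopped square function\<close>

lemma dyadic_mean_cmult: "dyadic_mean M k j (\<lambda>x. c * \<phi> x) = c * dyadic_mean M k j \<phi>"
  by (simp add: dyadic_mean_def mult.left_commute)

lemma sqfun2_eq_suminf:
  assumes "0 \<le> x" "x < 1"
  shows "sqfun2 \<mu> \<nu> x = (\<Sum>k. ennreal ((alpha \<mu> \<nu> (real (dyadic_index k x) / 2 ^ k)
    ((real (dyadic_index k x) + 1) / 2 ^ k))\<^sup>2))"
proof -
  have "(\<Sum>j<2 ^ k. g j * indicator (dyadic_int k j) x) = g (dyadic_index k x)"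
    for k and g :: "nat \<Rightarrow> ennreal"
  proof -
    have "(\<Sum>j<2 ^ k. g j * indicator (dyadic_int k j) x)
        = (\<Sum>j<2 ^ k. if j = dyadic_index k x then g j else 0)"
      using assms by (intro sum.cong) (auto simp: dyadic_int_iff indicator_def)
    then show ?thesis using dyadic_index_less[OF assms] by simp
  qed
  then show ?thesis by (simp add: sqfun2_def)
qed

lemma nn_integral_dyadic_sum:
  assumes [measurable_cong]: "sets M = sets borel"
  shows "(\<integral>\<^sup>+x. (\<Sum>j<2 ^ k. g j * indicator (dyadic_int k j) x) \<partial>M)
    = (\<Sum>j<2 ^ k. g j * emeasure M (dyadic_int k j))"
  by (subst nn_integral_sum) (auto simp: nn_integral_cmult)

context dyadic_pair
begin

definition \<alpha> :: "nat \<Rightarrow> nat \<Rightarrow> real" where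
  "\<alpha> k j = alpha \<mu> \<nu> (real j / 2 ^ k) ((real j + 1) / 2 ^ k)"

text \<open>Rescaling to the unit interval multiplies slopes by \<open>2 ^ k\<close>; dividing by it
  gives a 1-Lipschitz \<open>\<phi>\<close>, and the factor in \<open>W\<close> restores the
  size.\<close>

lemma test_le_W:
  assumes pos: "0 < m k j" and j: "j < 2 ^ k" and \<psi>: "1-lipschitz_on UNIV \<psi>"
  shows "\<bar>dyadic_mean \<mu> k j (\<lambda>x. \<psi> (x * 2 ^ k - j)) - dyadic_mean \<nu> k j (\<lambda>x. \<psi> (x * 2 ^ k - j))\<bar> \<le> W k j"
proof -
  define \<phi> :: "real \<Rightarrow> real" where "\<phi> = (\<lambda>x::real. \<psi> (x * 2 ^ k - j) / 2 ^ k)"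
  have eq: "(\<lambda>x::real. \<psi> (x * 2 ^ k - j)) = (\<lambda>x. 2 ^ k * \<phi> x)" by (simp add: \<phi>_def)
  have "1-lipschitz_on UNIV \<phi>"
    unfolding lipschitz_on_real_iff
  proof (intro allI)
    fix x y :: real
    have "\<bar>\<psi> (x * 2 ^ k - j) - \<psi> (y * 2 ^ k - j)\<bar> \<le> \<bar>(x * 2 ^ k - j) - (y * 2 ^ k - j)\<bar>"
      using \<psi> unfolding lipschitz_on_real_iff by blast
    also have "\<dots> = \<bar>x - y\<bar> * 2 ^ k"
      by (simp add: left_diff_distrib[symmetric] abs_mult)
    finally show "\<bar>\<phi> x - \<phi> y\<bar> \<le> \<bar>x - y\<bar>"
      by (simp add: \<phi>_def diff_divide_distrib[symmetric] divide_le_eq)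
  qed
  from W_ge[OF pos j this] show ?thesis
    unfolding eq dyadic_mean_cmult right_diff_distrib[symmetric] abs_mult by (simp add: mult.commute)
qed

text \<open>Positive mass for both measures excludes the null-measure case of \<open>blowup\<close>,
  so both integrals become averages of the rescaled test function.\<close>

lemma \<alpha>_eq:
  assumes pos: "0 < m k j" and j: "j < 2 ^ k"
  shows "\<alpha> k j = Sup {\<bar>dyadic_mean \<mu> k j (\<lambda>x. \<psi> (x * 2 ^ k - j)) - dyadic_mean \<nu> k j (\<lambda>x. \<psi> (x * 2 ^ k - j))\<bar>
    | \<psi>. 1-lipschitz_on UNIV \<psi> \<and> (\<forall>x. x \<notin> {0..1} \<longrightarrow> \<psi> x = 0)}"
  unfolding \<alpha>_def alpha_def W1_def dyadic_blowup_def[symmetric]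
  using lebesgue_integral_dyadic_blowup[OF sets_mu] lebesgue_integral_dyadic_blowup[OF sets_nu]
    pos n_pos[OF j] lipschitz_on_borel_measurable
  by (intro arg_cong[where f = Sup] Collect_cong) (metis m_def n_def)

lemma test_le_\<alpha>:
  assumes "0 < m k j" "j < 2 ^ k" "1-lipschitz_on UNIV \<psi>" "\<And>x. x \<notin> {0..1} \<Longrightarrow> \<psi> x = 0"
  shows "\<bar>dyadic_mean \<mu> k j (\<lambda>x. \<psi> (x * 2 ^ k - j)) - dyadic_mean \<nu> k j (\<lambda>x. \<psi> (x * 2 ^ k - j))\<bar> \<le> \<alpha> k j"
  unfolding \<alpha>_eq[OF assms(1,2)]
  using assms(3,4) test_le_W[OF assms(1,2)]
  by (intro cSup_upper) (auto simp: bdd_above_def)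

lemma \<alpha>_nonneg:
  assumes "0 < m k j" "j < 2 ^ k"
  shows "0 \<le> \<alpha> k j"
  using test_le_\<alpha>[OF assms lipschitz_on_zero] by simp

lemma \<alpha>_le_W:
  assumes "0 < m k j" "j < 2 ^ k"
  shows "\<alpha> k j \<le> W k j"
  unfolding \<alpha>_eq[OF assms]
  using test_le_W[OF assms] lipschitz_on_zero by (intro cSup_least) auto

text \<open>The set where the dyadic maximal function of \<mu> relative to \<nu> exceeds
  \<open>M\<close>.\<close>

definition large_ratio :: "real \<Rightarrow> real set" where
  "large_ratio M = (\<Union>k. \<Union>j\<in>{j. j < 2 ^ k \<and> M * n k j < m k j}. dyadic_int k j)"

lemma large_ratio_measurable [measurable]: "large_ratio M \<in> sets borel"
  by (simp add: large_ratio_def)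

lemma emeasure_dyadic_mu: "emeasure \<mu> (dyadic_int k j) = ennreal (m k j)"
  by (simp add: m_def mu.emeasure_eq_measure)

lemma emeasure_dyadic_nu: "emeasure \<nu> (dyadic_int k j) = ennreal (n k j)"
  by (simp add: n_def nu.emeasure_eq_measure)

text \<open>The weak-type estimate for the dyadic maximal function, with constant 1 since the
  maximal intervals are disjoint.\<close>

lemma nu_large_ratio_le:
  assumes "0 < M"
  shows "emeasure \<nu> (large_ratio M) \<le> ennreal (1 / M)"
proof -
  have "emeasure \<nu> (large_ratio M) \<le> ennreal (1 / M) * emeasure \<mu> (large_ratio M)"
    unfolding large_ratio_def
  proof (rule emeasure_Union_dyadic_le[OF sets_nu sets_mu])
    fix k j :: nat assume "j < 2 ^ k \<and> M * n k j < m k j"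
    then have "n k j \<le> 1 / M * m k j" using assms by (simp add: field_simps)
    then show "emeasure \<nu> (dyadic_int k j) \<le> ennreal (1 / M) * emeasure \<mu> (dyadic_int k j)"
      unfolding emeasure_dyadic_mu emeasure_dyadic_nu
      using assms by (subst ennreal_mult[symmetric]) (auto simp: ennreal_leI)
  qed
  also have "\<dots> \<le> ennreal (1 / M) * 1"
    by (intro mult_left_mono mu.emeasure_le_1) simp
  finally show ?thesis by simp
qed

lemma AE_mu_unit: "AE x in \<mu>. x \<in> {0..<1}"
  by (rule mu.AE_prob_1) (simp add: measure_def mu_unit)

text \<open>\<open>H\<close> is the square function stopped when the density exceeds
  \<open>M\<close>; \<open>stopped_W_sum\<close> bounds its \<mu>-integral. Off
  \<open>large_ratio M\<close> stopping never occurs, so \<open>H\<close> is the full square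
  function there.\<close>

lemma AE_sqfun2_finite:
  assumes "0 \<le> M"
  shows "AE x in \<mu>. x \<notin> large_ratio M \<longrightarrow> sqfun2 \<mu> \<nu> x < \<infinity>"
proof -
  define u :: "nat \<Rightarrow> nat \<Rightarrow> real" where "u = (\<lambda>k j. of_bool (along_ancestors (\<lambda>k j. m k j \<le> M * n k j) k j))"
  have u_nonneg: "0 \<le> u k j" for k j by (simp add: u_def)
  define H where "H = (\<lambda>x. \<Sum>k. \<Sum>j<2 ^ k. ennreal (u k j * (\<alpha> k j)\<^sup>2) * indicator (dyadic_int k j) x)"
  have [measurable]: "H \<in> borel_measurable \<mu>" unfolding H_def by measurable
  have "(\<integral>\<^sup>+x. H x \<partial>\<mu>) = (\<Sum>k. \<Sum>j<2 ^ k. ennreal (u k j * (\<alpha> k j)\<^sup>2) * emeasure \<mu> (dyadic_int k j))"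
    unfolding H_def nn_integral_dyadic_sum[OF sets_mu, symmetric]
    by (rule nn_integral_suminf) measurable
  also have "\<dots> \<le> (\<Sum>k. ennreal (\<Sum>j<2 ^ k. u k j * (m k j * (W k j)\<^sup>2)))"
  proof (intro suminf_le allI summableI)
    fix k
    have "ennreal (u k j * (\<alpha> k j)\<^sup>2) * emeasure \<mu> (dyadic_int k j) \<le> ennreal (u k j * (m k j * (W k j)\<^sup>2))"
      if j: "j < 2 ^ k" for j
    proof (cases "m k j = 0")
      case False
      then have pos: "0 < m k j" using m_nonneg[of k j] by linarith
      have "(\<alpha> k j)\<^sup>2 \<le> (W k j)\<^sup>2"
        by (intro power_mono \<alpha>_le_W \<alpha>_nonneg pos j)
      then have "u k j * (\<alpha> k j)\<^sup>2 * m k j \<le> u k j * (m k j * (W k j)\<^sup>2)"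
        by (auto simp: u_def mult.commute intro: mult_left_mono)
      then show ?thesis
        unfolding emeasure_dyadic_mu by (subst ennreal_mult[symmetric]) (auto simp: u_def ennreal_leI)
    qed (simp add: emeasure_dyadic_mu)
    then have "(\<Sum>j<2 ^ k. ennreal (u k j * (\<alpha> k j)\<^sup>2) * emeasure \<mu> (dyadic_int k j))
        \<le> (\<Sum>j<2 ^ k. ennreal (u k j * (m k j * (W k j)\<^sup>2)))"
      by (intro sum_mono) simp
    then show "(\<Sum>j<2 ^ k. ennreal (u k j * (\<alpha> k j)\<^sup>2) * emeasure \<mu> (dyadic_int k j))
        \<le> ennreal (\<Sum>j<2 ^ k. u k j * (m k j * (W k j)\<^sup>2))"
      by (simp add: sum_ennreal u_nonneg)
  qed
  also have "\<dots> \<le> ennreal (16 * sqrt M + 8)"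
  proof (rule suminf_le_const)
    fix N
    show "(\<Sum>k<N. ennreal (\<Sum>j<2 ^ k. u k j * (m k j * (W k j)\<^sup>2))) \<le> ennreal (16 * sqrt M + 8)"
      using stopped_W_sum[OF assms, of N] unfolding u_def
      by (subst sum_ennreal) (auto intro!: sum_nonneg ennreal_leI)
  qed simp
  finally have "(\<integral>\<^sup>+x. H x \<partial>\<mu>) \<noteq> \<infinity>" by (auto simp: top_unique)
  then have "AE x in \<mu>. H x \<noteq> \<infinity>" by (intro nn_integral_PInf_AE) simp_all
  then show ?thesis
    using AE_mu_unit
  proof eventually_elim
    fix x assume x: "H x \<noteq> \<infinity>" "x \<in> {0..<1}"
    show "x \<notin> large_ratio M \<longrightarrow> sqfun2 \<mu> \<nu> x < \<infinity>"
    proof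
      assume nl: "x \<notin> large_ratio M"
      have *: "m k (dyadic_index k x) \<le> M * n k (dyadic_index k x)" for k
      proof (rule ccontr)
        assume "\<not> ?thesis"
        moreover have "dyadic_index k x < 2 ^ k" "x \<in> dyadic_int k (dyadic_index k x)"
          using x(2) dyadic_index_less[of x k] by (simp_all add: dyadic_int_iff)
        ultimately have "x \<in> large_ratio M"
          unfolding large_ratio_def not_le by blast
        then show False using nl by simp
      qed
      have "u k (dyadic_index k x) = 1" for k
        using along_ancestors_dyadic_index[of x "\<lambda>k j. m k j \<le> M * n k j" k] * x(2) by (simp add: u_def)
      then have "u k j * (\<alpha> k j)\<^sup>2 = (\<alpha> k j)\<^sup>2" if "x \<in> dyadic_int k j" for k j
        using that by (auto simp: dyadic_int_iff)
      then have "ennreal (u k j * (\<alpha> k j)\<^sup>2) * indicator (dyadic_int k j) x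
          = ennreal ((\<alpha> k j)\<^sup>2) * indicator (dyadic_int k j) x" for k j
        by (cases "x \<in> dyadic_int k j") (simp_all only: indicator_simps mult_zero_right not_False_eq_True)
      then have "H x = sqfun2 \<mu> \<nu> x" unfolding H_def sqfun2_def \<alpha>_def by simp
      then show "sqfun2 \<mu> \<nu> x < \<infinity>" using x by (simp add: less_top)
    qed
  qed
qed

end

section \<open>Divergence on the singular part\<close>

definition tent :: "real \<Rightarrow> real" where "tent t = max 0 (min t (1 - t))"

lemma tent_lipschitz: "\<bar>tent s - tent t\<bar> \<le> \<bar>s - t\<bar>"
  unfolding tent_def max_def min_def by (smt (verit))

lemma tent_bounds: "0 \<le> tent t" "tent t \<le> 1"
  by (simp_all add: tent_def)

lemma tent_measurable [measurable]: "tent \<in> borel_measurable borel"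
  unfolding tent_def[abs_def] by measurable

context dyadic_pair
begin

text \<open>The proportions of the two children add up to 1 for both measures, so passing to the
  right child only changes the sign.\<close>

lemma child_ratio_diff:
  assumes "0 < m k j" "j < 2 ^ k" "i div 2 = j"
  shows "\<bar>m (Suc k) i / m k j - n (Suc k) i / n k j\<bar> = \<bar>\<Delta> k j\<bar>"
proof (cases "i = 2 * j")
  case False
  then have i: "i = Suc (2 * j)" using assms(3) by presburger
  have "m (Suc k) i / m k j = 1 - m (Suc k) (2 * j) / m k j"
    using assms(1) m_children[of k j] by (simp add: i field_simps)
  moreover have "n (Suc k) i / n k j = 1 - n (Suc k) (2 * j) / n k j"
    using n_pos[OF assms(2)] n_children[of k j] by (simp add: i field_simps)
  ultimately show ?thesis by (simp add: \<Delta>_def)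
qed (simp add: \<Delta>_def)

text \<open>On the second quarter of the interval the tent is at least 1/4. That quarter lies two
  generations down, so doubling, applied twice, leaves it a proportion of at least
  \<open>1 / C\<^sup>2\<close>.\<close>

lemma tent_mean_ge:
  assumes j: "j < 2 ^ k"
  shows "1 / (4 * C\<^sup>2) \<le> dyadic_mean \<nu> k j (\<lambda>x. tent (x * 2 ^ k - j))"
proof -
  let ?Q = "dyadic_int (Suc (Suc k)) (4 * j + 1)"
  have Q: "?Q \<subseteq> dyadic_int k j" "x \<in> ?Q \<Longrightarrow> 1 / 4 \<le> tent (x * 2 ^ k - j)" for x
    by (auto simp: dyadic_int_def tent_def field_simps)
  have i: "4 * j + 1 < 2 ^ Suc (Suc k)" using j by simp
  have "n k j \<le> C * n (Suc k) (2 * j)"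
    using n_parent_le[of "2 * j" k] j by simp
  also have "n (Suc k) (2 * j) \<le> C * n (Suc (Suc k)) (4 * j + 1)"
    using n_parent_le[OF i] by simp
  finally have nQ: "n k j \<le> C\<^sup>2 * n (Suc (Suc k)) (4 * j + 1)"
    using C_ge_1 by (simp add: power2_eq_square mult_left_mono)
  have "n (Suc (Suc k)) (4 * j + 1) / 4 = (\<integral>x. indicator ?Q x * (1 / 4) \<partial>\<nu>)"
    using sets_eq_imp_space_eq[OF sets_nu] by (simp add: n_def)
  also have "\<dots> \<le> (\<integral>x. indicator (dyadic_int k j) x * tent (x * 2 ^ k - j) \<partial>\<nu>)"
  proof (rule integral_mono)
    show "integrable \<nu> (\<lambda>x. indicat_real ?Q x * (1 / 4))"
      by (intro integrable_mult_left integrable_real_indicator) (auto simp: sets_nu less_top[symmetric])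
    show "integrable \<nu> (\<lambda>x. indicator (dyadic_int k j) x * tent (x * 2 ^ k - j))"
      by (rule indicator_mult_integrable[OF nu.finite_measure_axioms sets_nu, where c = 0 and h = 1])
        (auto simp: tent_bounds)
    show "indicator ?Q x * (1 / 4) \<le> indicator (dyadic_int k j) x * tent (x * 2 ^ k - j)" for x
      using Q tent_bounds(1) by (auto simp: indicator_def)
  qed
  finally have "n (Suc (Suc k)) (4 * j + 1) / 4 / n k j \<le> dyadic_mean \<nu> k j (\<lambda>x. tent (x * 2 ^ k - j))"
    unfolding dyadic_mean_def n_def[symmetric] by (rule divide_right_mono) simp
  moreover have "1 / (4 * C\<^sup>2) \<le> n (Suc (Suc k)) (4 * j + 1) / 4 / n k j"
    using nQ n_pos[OF j] C_ge_1 by (simp add: field_simps)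
  ultimately show ?thesis by linarith
qed

text \<open>The integrand is the tent of the child written in the coordinate of the parent, with
  \<open>i mod 2\<close> choosing the half. It vanishes off the child, so only the normalizing mass
  changes; halving it keeps the slope at 1.\<close>

lemma tent_mean_parent:
  assumes M: "finite_measure M" "sets M = sets borel"
    and pos: "0 < measure M (dyadic_int k j)" "0 < measure M (dyadic_int (Suc k) i)" and ij: "i div 2 = j"
  shows "dyadic_mean M k j (\<lambda>x. tent (2 * (x * 2 ^ k - j) - real (i mod 2)) / 2)
    = measure M (dyadic_int (Suc k) i) / measure M (dyadic_int k j)
      * dyadic_mean M (Suc k) i (\<lambda>x. tent (x * 2 ^ Suc k - i)) / 2"
proof -
  have "real i = 2 * real j + real (i mod 2)"
    by (metis ij mult_div_mod_eq of_nat_add of_nat_mult of_nat_numeral)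
  then have eq: "2 * (x * 2 ^ k - j) - real (i mod 2) = x * 2 ^ Suc k - i" for x :: real
    by (simp add: algebra_simps)
  have sub: "dyadic_int (Suc k) i \<subseteq> dyadic_int k j"
    using dyadic_int_ancestor[of k "Suc k" i] ij by simp
  have zero: "tent (x * 2 ^ Suc k - i) = 0" if "x \<notin> dyadic_int (Suc k) i" for x
    using that by (auto simp: tent_def dyadic_int_def field_simps)
  have "(\<lambda>x. indicator (dyadic_int k j) x * (tent (x * 2 ^ Suc k - i) / 2))
      = (\<lambda>x. indicator (dyadic_int (Suc k) i) x * tent (x * 2 ^ Suc k - i) / 2)"
  proof
    fix x show "indicator (dyadic_int k j) x * (tent (x * 2 ^ Suc k - i) / 2)
      = indicator (dyadic_int (Suc k) i) x * tent (x * 2 ^ Suc k - i) / 2"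
      using zero[of x] sub by (cases "x \<in> dyadic_int (Suc k) i") auto
  qed
  then show ?thesis
    using pos unfolding eq dyadic_mean_def by simp
qed

text \<open>The tent over the child is an admissible test function, up to scaling, both for the
  child and for the parent; comparing the two averages of it recovers the ratio of the masses.\<close>
lemma \<Delta>_le_\<alpha>:
  assumes pos: "0 < m (Suc k) i" and i: "i < 2 ^ Suc k" and ij: "i div 2 = j"
  shows "\<bar>\<Delta> k j\<bar> \<le> 4 * C\<^sup>2 * (2 * \<alpha> k j + \<alpha> (Suc k) i)"
proof -
  have j: "j < 2 ^ k" using i ij by auto
  have "i = 2 * j \<or> i = Suc (2 * j)" using ij by presburger
  then have le: "m (Suc k) i \<le> m k j" using m_children[of k j] m_nonneg[of "Suc k" "2 * j"] m_nonneg[of "Suc k" "Suc (2 * j)"]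
    by auto
  then have mpos: "0 < m k j" using pos by linarith
  note npos = n_pos[OF j] n_pos[OF i]
  define s t where "s = dyadic_mean \<mu> (Suc k) i (\<lambda>x. tent (x * 2 ^ Suc k - i))"
    and "t = dyadic_mean \<nu> (Suc k) i (\<lambda>x. tent (x * 2 ^ Suc k - i))"
  define p q where "p = m (Suc k) i / m k j" and "q = n (Suc k) i / n k j"
  have p01: "0 \<le> p" "p \<le> 1" using le mpos by (simp_all add: p_def)
  have child: "\<bar>s - t\<bar> \<le> \<alpha> (Suc k) i"
    unfolding s_def t_def using tent_lipschitz
    by (intro test_le_\<alpha> pos i) (auto simp: lipschitz_on_real_iff tent_def)
  define \<psi> where "\<psi> = (\<lambda>y. tent (2 * y - real (i mod 2)) / 2)"
  have lip: "1-lipschitz_on UNIV \<psi>"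
    unfolding lipschitz_on_real_iff
  proof (intro allI)
    fix x y :: real
    have "\<bar>tent (2 * x - real (i mod 2)) - tent (2 * y - real (i mod 2))\<bar> \<le> \<bar>2 * x - 2 * y\<bar>"
      using tent_lipschitz[of "2 * x - real (i mod 2)" "2 * y - real (i mod 2)"] by simp
    then show "\<bar>\<psi> x - \<psi> y\<bar> \<le> \<bar>x - y\<bar>" unfolding \<psi>_def by linarith
  qed
  have "real (i mod 2) \<in> {0, 1}" by (auto simp: mod_2_eq_odd)
  then have supp: "\<psi> x = 0" if "x \<notin> {0..1}" for x using that by (auto simp: \<psi>_def tent_def)
  have "dyadic_mean \<mu> k j (\<lambda>x. \<psi> (x * 2 ^ k - j)) = p * s / 2"
    unfolding \<psi>_def p_def s_def m_def
    using pos mpos by (intro tent_mean_parent mu.finite_measure_axioms sets_mu ij) (simp_all add: m_def)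
  moreover have "dyadic_mean \<nu> k j (\<lambda>x. \<psi> (x * 2 ^ k - j)) = q * t / 2"
    unfolding \<psi>_def q_def t_def n_def
    using npos by (intro tent_mean_parent nu.finite_measure_axioms sets_nu ij) (simp_all add: n_def)
  ultimately have parent: "\<bar>p * s / 2 - q * t / 2\<bar> \<le> \<alpha> k j"
    using test_le_\<alpha>[OF mpos j lip supp] by simp
  have t: "1 / (4 * C\<^sup>2) \<le> t" unfolding t_def by (rule tent_mean_ge[OF i])
  have "\<bar>p - q\<bar> * (1 / (4 * C\<^sup>2)) \<le> \<bar>p - q\<bar> * t" by (rule mult_left_mono[OF t]) simp
  \<comment> \<open>This expresses \<open>(p - q) * t\<close> through the errors seen at the parent
    and at the child; the lower bound on \<open>t\<close> then isolates
    \<open>p - q\<close>.\<close>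
  also have "\<dots> = \<bar>(p * s - q * t) - p * (s - t)\<bar>"
  proof -
    have "0 \<le> 1 / (4 * C\<^sup>2)" by simp
    then have "0 \<le> t" using t by linarith
    then have "\<bar>p - q\<bar> * t = \<bar>(p - q) * t\<bar>" by (simp add: abs_mult)
    then show ?thesis by (simp add: algebra_simps)
  qed
  also have "\<dots> \<le> \<bar>p * s - q * t\<bar> + p * \<bar>s - t\<bar>"
    using p01 abs_triangle_ineq4[of "p * s - q * t" "p * (s - t)"] by (simp add: abs_mult)
  also have "\<dots> \<le> 2 * \<alpha> k j + 1 * \<alpha> (Suc k) i"
    using parent child p01 by (intro add_mono mult_mono) auto
  finally have "\<bar>p - q\<bar> \<le> 4 * C\<^sup>2 * (2 * \<alpha> k j + \<alpha> (Suc k) i)"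
    using C_ge_1 by (simp add: field_simps)
  then show ?thesis using child_ratio_diff[OF mpos j ij] by (simp add: p_def q_def)
qed

section \<open>The compensated density as a supermartingale\<close>

primrec compensator :: "nat \<Rightarrow> nat \<Rightarrow> real" where
  "compensator 0 j = 1"
| "compensator (Suc k) j = compensator k (j div 2) * (1 + C\<^sup>2 * (\<Delta> k (j div 2))\<^sup>2)"

lemma compensator_pos [simp]: "0 < compensator k j"
  by (induction k arbitrary: j) (simp_all add: add_pos_nonneg)

lemma compensator_le:
  assumes "0 \<le> x"
  shows "compensator k (dyadic_index k x) \<le> exp (C\<^sup>2 * (\<Sum>i<k. (\<Delta> i (dyadic_index i x))\<^sup>2))"
proof (induction k)
  case (Suc k)
  have "compensator (Suc k) (dyadic_index (Suc k) x)
      = compensator k (dyadic_index k x) * (1 + C\<^sup>2 * (\<Delta> k (dyadic_index k x))\<^sup>2)"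
    unfolding compensator.simps(2) dyadic_index_parent[OF assms] ..
  also have "\<dots> \<le> exp (C\<^sup>2 * (\<Sum>i<k. (\<Delta> i (dyadic_index i x))\<^sup>2)) * exp (C\<^sup>2 * (\<Delta> k (dyadic_index k x))\<^sup>2)"
    by (intro mult_mono Suc exp_ge_add_one_self) auto
  finally show ?case by (simp add: exp_add[symmetric] distrib_left)
qed simp

text \<open>The density divided by the compensator; along dyadic intervals it is a nonnegative
  supermartingale with respect to \<open>\<mu>\<close>.\<close>
definition Y :: "nat \<Rightarrow> nat \<Rightarrow> real" where
  "Y k j = m k j / (n k j * compensator k j)"

lemma Y_nonneg: "0 \<le> Y k j"
  by (simp add: Y_def less_imp_le)

text \<open>By \<open>chi_square_eq\<close> the density grows on average by
  \<open>1 + (p - q)\<^sup>2 / (q * (1 - q))\<close>. Doubling gives \<open>q\<close> and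
  \<open>1 - q\<close> at least \<open>1 / C\<close>, so this is at most the factor \<open>d\<close>
  that the compensator acquires, which is the same on both children.\<close>

lemma Y_supermartingale:
  assumes j: "j < 2 ^ k"
  shows "m (Suc k) (2 * j) * Y (Suc k) (2 * j) + m (Suc k) (Suc (2 * j)) * Y (Suc k) (Suc (2 * j)) \<le> m k j * Y k j"
proof (cases "m k j = 0")
  case True
  then have "m (Suc k) (2 * j) = 0" "m (Suc k) (Suc (2 * j)) = 0"
    using m_children[of k j] m_nonneg[of "Suc k" "2 * j"] m_nonneg[of "Suc k" "Suc (2 * j)"] by linarith+
  then show ?thesis using True by simp
next
  case False
  then have pos: "0 < m k j" using m_nonneg[of k j] by linarith
  have npos: "0 < n k j" by (rule n_pos[OF j])
  define p q where "p = m (Suc k) (2 * j) / m k j" and "q = n (Suc k) (2 * j) / n k j"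
  have p: "m (Suc k) (2 * j) = p * m k j" "m (Suc k) (Suc (2 * j)) = (1 - p) * m k j"
    using pos m_children[of k j] by (simp_all add: p_def field_simps)
  have q: "n (Suc k) (2 * j) = q * n k j" "n (Suc k) (Suc (2 * j)) = (1 - q) * n k j"
    using npos n_children[of k j] by (simp_all add: q_def field_simps)
  have "n k j \<le> C * n (Suc k) (2 * j)" "n k j \<le> C * n (Suc k) (Suc (2 * j))"
    using n_parent_le[of "2 * j" k] n_parent_le[of "Suc (2 * j)" k] j by simp_all
  then have Cq: "1 \<le> C * q" "1 \<le> C * (1 - q)" unfolding q using npos by simp_all
  then have q01: "0 < q" "q < 1" using C_ge_1 by (smt (verit) zero_less_mult_iff)+
  define d where "d = 1 + C\<^sup>2 * (\<Delta> k j)\<^sup>2"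
  have dpos: "0 < d" by (simp add: d_def add_pos_nonneg)
  have D: "\<Delta> k j = p - q" by (simp add: \<Delta>_def p_def q_def)
  have "1 * 1 \<le> (C * q) * (C * (1 - q))" using Cq by (intro mult_mono) auto
  then have "1 / (q * (1 - q)) \<le> C\<^sup>2"
    using q01 by (simp add: divide_le_eq power2_eq_square mult_ac)
  then have "1 / (q * (1 - q)) * (p - q)\<^sup>2 \<le> C\<^sup>2 * (p - q)\<^sup>2" by (rule mult_right_mono) simp
  then have chi: "p\<^sup>2 / q + (1 - p)\<^sup>2 / (1 - q) \<le> d"
    unfolding chi_square_eq[OF q01] d_def D by simp
  have "m (Suc k) (2 * j) * Y (Suc k) (2 * j) + m (Suc k) (Suc (2 * j)) * Y (Suc k) (Suc (2 * j))
      = m k j * Y k j * ((p\<^sup>2 / q + (1 - p)\<^sup>2 / (1 - q)) / d)"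
  proof -
    have "compensator (Suc k) (2 * j) = compensator k j * d" "compensator (Suc k) (Suc (2 * j)) = compensator k j * d"
      by (simp_all add: d_def)
    then show ?thesis unfolding Y_def p q
      by (simp only: add_divide_distrib distrib_left) (simp add: power2_eq_square mult_ac)
  qed
  also have "\<dots> \<le> m k j * Y k j * 1"
    using chi dpos Y_nonneg by (intro mult_left_mono) (simp_all add: divide_le_eq)
  finally show ?thesis by simp
qed

lemma sum_Y_le: "(\<Sum>j<2 ^ k. m k j * Y k j) \<le> 1"
proof (induction k)
  case (Suc k)
  have "(\<Sum>j<2 ^ Suc k. m (Suc k) j * Y (Suc k) j) \<le> (\<Sum>j<2 ^ k. m k j * Y k j)"
    unfolding power_Suc sum_lessThan_double by (intro sum_mono Y_supermartingale) simp
  then show ?case using Suc by linarith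
qed (simp add: Y_def m_root n_root)

text \<open>The \<mu>-integrals of \<open>Y\<close> are at most 1 in every generation, so by Fatou
  its lower limit is finite almost everywhere. A finite lower limit means a bound that holds for
  infinitely many generations.\<close>

lemma AE_frequently_Y_le:
  "AE x in \<mu>. \<exists>B::nat. \<exists>\<^sub>F k in sequentially. Y k (dyadic_index k x) \<le> B"
proof -
  define F where "F = (\<lambda>k x. \<Sum>j<2 ^ k. ennreal (Y k j) * indicator (dyadic_int k j) x)"
  have [measurable]: "F k \<in> borel_measurable \<mu>" for k unfolding F_def by measurable
  have "(\<integral>\<^sup>+x. F k x \<partial>\<mu>) \<le> 1" for k
  proof -
    have "(\<integral>\<^sup>+x. F k x \<partial>\<mu>) = (\<Sum>j<2 ^ k. ennreal (m k j * Y k j))"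
      unfolding F_def nn_integral_dyadic_sum[OF sets_mu] emeasure_dyadic_mu
      by (intro sum.cong refl) (simp add: ennreal_mult[symmetric] Y_nonneg mult.commute)
    also have "\<dots> = ennreal (\<Sum>j<2 ^ k. m k j * Y k j)"
      by (intro sum_ennreal) (simp add: Y_nonneg)
    also have "\<dots> \<le> 1" using sum_Y_le[of k] by simp
    finally show ?thesis .
  qed
  then have "(\<integral>\<^sup>+x. liminf (\<lambda>k. F k x) \<partial>\<mu>) \<le> 1"
    by (intro order_trans[OF nn_integral_liminf] order_trans[OF Liminf_le_Limsup] Limsup_bounded) auto
  then have "(\<integral>\<^sup>+x. liminf (\<lambda>k. F k x) \<partial>\<mu>) \<noteq> \<infinity>" by (auto simp: top_unique)
  then have "AE x in \<mu>. liminf (\<lambda>k. F k x) \<noteq> \<infinity>" by (intro nn_integral_PInf_AE) simp_all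
  then show ?thesis
    using AE_mu_unit
  proof eventually_elim
    fix x assume x: "liminf (\<lambda>k. F k x) \<noteq> \<infinity>" "x \<in> {0..<1}"
    have F: "F k x = ennreal (Y k (dyadic_index k x))" for k
    proof -
      have "F k x = (\<Sum>j<2 ^ k. if j = dyadic_index k x then ennreal (Y k j) else 0)"
        unfolding F_def using x by (intro sum.cong) (auto simp: dyadic_int_iff indicator_def)
      then show ?thesis using dyadic_index_less[of x k] x by simp
    qed
    show "\<exists>B::nat. \<exists>\<^sub>F k in sequentially. Y k (dyadic_index k x) \<le> B"
    proof (rule ccontr)
      assume "\<not> ?thesis"
      then have ev: "\<forall>\<^sub>F k in sequentially. real B \<le> Y k (dyadic_index k x)" for B :: nat
        by (auto simp: not_frequently not_le elim!: eventually_mono dest: spec[of _ B])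
      have "of_nat B \<le> liminf (\<lambda>k. F k x)" for B :: nat
        unfolding F using ev[of B]
        by (intro Liminf_bounded) (auto simp: ennreal_of_nat_eq_real_of_nat ennreal_leI elim: eventually_mono)
      moreover obtain b :: nat where "liminf (\<lambda>k. F k x) \<le> of_nat b"
        using x(1) ennreal_Ex_less_of_nat[of "liminf (\<lambda>k. F k x)"] by (auto simp: less_top intro: less_imp_le)
      ultimately have "(of_nat (Suc b) :: ennreal) \<le> of_nat b" by (rule order_trans)
      then show False by (simp only: of_nat_le_iff)
    qed
  qed
qed

lemma AE_mu_pos: "AE x in \<mu>. \<forall>k. 0 < m k (dyadic_index k x)"
  unfolding AE_all_countable
proof
  fix k
  have "AE x in \<mu>. \<forall>j. m k j = 0 \<longrightarrow> x \<notin> dyadic_int k j"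
    unfolding AE_all_countable
  proof
    fix j show "AE x in \<mu>. m k j = 0 \<longrightarrow> x \<notin> dyadic_int k j"
      by (cases "m k j = 0")
        (auto simp: m_def mu.emeasure_eq_measure sets_mu intro!: AE_not_in null_setsI)
  qed
  then show "AE x in \<mu>. 0 < m k (dyadic_index k x)"
    using AE_mu_unit
  proof eventually_elim
    fix x assume "\<forall>j. m k j = 0 \<longrightarrow> x \<notin> dyadic_int k j" "x \<in> {0..<1}"
    then have "m k (dyadic_index k x) \<noteq> 0" by (auto simp: dyadic_int_iff)
    then show "0 < m k (dyadic_index k x)" using m_nonneg[of k "dyadic_index k x"] by linarith
  qed
qed

text \<open>\<open>\<Delta>_le_\<alpha>\<close> bounds each \<open>\<Delta>\<^sup>2\<close> by the
  squares of \<alpha> in two consecutive generations, so \<open>\<Delta>\<^sup>2\<close> is summable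
  along \<open>x\<close> and \<open>compensator_le\<close> gives a uniform bound.\<close>

lemma compensator_bounded:
  assumes x: "0 \<le> x" "x < 1" and pos: "\<And>k. 0 < m k (dyadic_index k x)"
    and fin: "sqfun2 \<mu> \<nu> x < \<infinity>"
  shows "\<exists>L. \<forall>k. compensator k (dyadic_index k x) \<le> L"
proof -
  define a d where "a = (\<lambda>k. \<alpha> k (dyadic_index k x))" and "d = (\<lambda>k. \<Delta> k (dyadic_index k x))"
  have "(\<Sum>k. ennreal ((a k)\<^sup>2)) \<noteq> top"
    using fin unfolding sqfun2_eq_suminf[OF x] a_def \<alpha>_def by simp
  then have sa: "summable (\<lambda>k. (a k)\<^sup>2)"
    by (intro summable_suminf_not_top) auto
  define K where "K = (4 * C\<^sup>2)\<^sup>2"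
  have le: "(d k)\<^sup>2 \<le> K * (8 * (a k)\<^sup>2 + 2 * (a (Suc k))\<^sup>2)" for k
  proof -
    have "\<bar>d k\<bar> \<le> 4 * C\<^sup>2 * (2 * a k + a (Suc k))"
      unfolding d_def a_def
      by (rule \<Delta>_le_\<alpha>) (use pos dyadic_index_less[OF x] dyadic_index_parent[OF x(1)] in blast)+
    then have "\<bar>d k\<bar>\<^sup>2 \<le> (4 * C\<^sup>2 * (2 * a k + a (Suc k)))\<^sup>2" by (rule power_mono) simp
    also have "\<dots> = K * (2 * a k + a (Suc k))\<^sup>2" by (simp add: K_def power_mult_distrib)
    also have "\<dots> \<le> K * (8 * (a k)\<^sup>2 + 2 * (a (Suc k))\<^sup>2)"
    proof (rule mult_left_mono)
      show "(2 * a k + a (Suc k))\<^sup>2 \<le> 8 * (a k)\<^sup>2 + 2 * (a (Suc k))\<^sup>2"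
        using zero_le_power2[of "2 * a k - a (Suc k)"] by (simp add: power2_sum power2_diff power_mult_distrib)
    qed (simp add: K_def)
    finally show ?thesis by simp
  qed
  have "summable (\<lambda>k. K * (8 * (a k)\<^sup>2 + 2 * (a (Suc k))\<^sup>2))"
    using sa by (intro summable_mult summable_add) (simp_all only: summable_Suc_iff[of "\<lambda>k. (a k)\<^sup>2"])
  then have sd: "summable (\<lambda>k. (d k)\<^sup>2)"
    by (rule summable_comparison_test'[where N = 0]) (simp only: real_norm_def abs_power2 le)
  have "compensator k (dyadic_index k x) \<le> exp (C\<^sup>2 * (\<Sum>k. (d k)\<^sup>2))" for k
  proof -
    have "compensator k (dyadic_index k x) \<le> exp (C\<^sup>2 * (\<Sum>i<k. (d i)\<^sup>2))"
      unfolding d_def by (rule compensator_le[OF x(1)])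
    also have "\<dots> \<le> exp (C\<^sup>2 * (\<Sum>k. (d k)\<^sup>2))"
      using sum_le_suminf[OF sd, of "{..<k}"] by (simp add: mult_left_mono)
    finally show ?thesis .
  qed
  then show ?thesis by blast
qed

text \<open>Whenever \<open>Y\<close> is at most \<open>B\<close> and the compensator at most
  \<open>L\<close>, the density is at most \<open>B * L\<close>.\<close>

lemma AE_frequently_density_le:
  "AE x in \<mu>. sqfun2 \<mu> \<nu> x < \<infinity> \<longrightarrow>
    (\<exists>M::nat. \<exists>\<^sub>F k in sequentially. m k (dyadic_index k x) \<le> M * n k (dyadic_index k x))"
  using AE_frequently_Y_le AE_mu_pos AE_mu_unit
proof eventually_elim
  fix x assume Y: "\<exists>B::nat. \<exists>\<^sub>F k in sequentially. Y k (dyadic_index k x) \<le> B"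
    and pos: "\<forall>k. 0 < m k (dyadic_index k x)" and x: "x \<in> {0..<1}"
  show "sqfun2 \<mu> \<nu> x < \<infinity> \<longrightarrow>
    (\<exists>M::nat. \<exists>\<^sub>F k in sequentially. m k (dyadic_index k x) \<le> M * n k (dyadic_index k x))"
  proof
    assume "sqfun2 \<mu> \<nu> x < \<infinity>"
    then obtain L where L: "\<And>k. compensator k (dyadic_index k x) \<le> L"
      using compensator_bounded[of x] pos x by auto
    obtain B :: nat where B: "\<exists>\<^sub>F k in sequentially. Y k (dyadic_index k x) \<le> B" using Y by blast
    obtain M :: nat where M: "B * L \<le> M" using real_arch_simple by blast
    have "m k j \<le> M * n k j" if "Y k j \<le> B" "j = dyadic_index k x" for k j
    proof -
      have npos: "0 < n k j" using that x dyadic_index_less[of x k] n_pos by simp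
      then have "m k j \<le> B * (n k j * compensator k j)"
        using that(1) by (simp add: Y_def divide_le_eq)
      also have "\<dots> \<le> B * (n k j * L)"
        using L that npos by (intro mult_left_mono) auto
      also have "\<dots> = B * L * n k j" by simp
      also have "\<dots> \<le> M * n k j" using M npos by (intro mult_right_mono) auto
      finally show ?thesis .
    qed
    then show "\<exists>M::nat. \<exists>\<^sub>F k in sequentially. m k (dyadic_index k x) \<le> M * n k (dyadic_index k x)"
      using B by (intro exI[of _ M]) (auto elim: frequently_mono[rotated])
  qed
qed

text \<open>Outer regularity encloses \<open>N\<close> in an open set of small \<nu>-measure. Each
  exceptional point lies in a dyadic interval inside that open set with density at most
  \<open>M\<close>, and the union of these intervals has \<mu>-measure at most \<open>M\<close>
  times the small number.\<close>

lemma mu_bounded_density_null: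
  fixes M :: real
  assumes N: "N \<in> sets borel" "emeasure \<nu> N = 0" and "0 \<le> M"
  shows "AE x in \<mu>. x \<in> N \<longrightarrow> \<not> (\<exists>\<^sub>F k in sequentially. m k (dyadic_index k x) \<le> M * n k (dyadic_index k x))"
proof -
  define E where "E = {x \<in> {0..<1} \<inter> N. \<exists>\<^sub>F k in sequentially. m k (dyadic_index k x) \<le> M * n k (dyadic_index k x)}"
  have cover: "\<exists>G \<in> sets borel. E \<subseteq> G \<and> emeasure \<mu> G \<le> ennreal M * e" if "0 < e" for e :: ennreal
  proof -
    have "emeasure \<nu> N = (INF U\<in>{U. N \<subseteq> U \<and> open U}. emeasure \<nu> U)"
      by (rule outer_regular) (use N in \<open>auto simp: sets_nu\<close>)
    then have "(INF U\<in>{U. N \<subseteq> U \<and> open U}. emeasure \<nu> U) < e" using N that by simp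
    then obtain U where U: "N \<subseteq> U" "open U" "emeasure \<nu> U < e" unfolding INF_less_iff by auto
    define P where "P = (\<lambda>k j. m k j \<le> M * n k j \<and> dyadic_int k j \<subseteq> U)"
    define G where "G = (\<Union>k. \<Union>j\<in>{j. P k j}. dyadic_int k j)"
    have "E \<subseteq> G"
    proof
      fix x assume "x \<in> E"
      then have x: "x \<in> U" "0 \<le> x" and
        fr: "\<exists>\<^sub>F k in sequentially. m k (dyadic_index k x) \<le> M * n k (dyadic_index k x)"
        using U by (auto simp: E_def)
      obtain r where r: "0 < r" "ball x r \<subseteq> U" using U x open_contains_ball by blast
      obtain k0 where k0: "(1 / 2) ^ k0 < r" using r real_arch_pow_inv[of r "1 / 2"] by auto
      \<comment> \<open>The density bound recurs in arbitrarily late generations, so the interval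
        can be taken short enough to fit into the ball.\<close>
      obtain k where k: "k0 \<le> k" "m k (dyadic_index k x) \<le> M * n k (dyadic_index k x)"
        using fr unfolding frequently_sequentially by blast
      have "(1 / 2 :: real) ^ k \<le> (1 / 2) ^ k0" using k by (intro power_decreasing) auto
      then have "1 / 2 ^ k < r" using k0 by (simp add: power_divide)
      moreover have xI: "x \<in> dyadic_int k (dyadic_index k x)" using x by (simp add: dyadic_int_iff)
      ultimately have "dyadic_int k (dyadic_index k x) \<subseteq> ball x r"
        using dyadic_int_dist[of _ k "dyadic_index k x" x]
        by (force simp: dyadic_int_def[of k "dyadic_index k x"] dist_real_def abs_minus_commute)
      then show "x \<in> G" using k r xI unfolding G_def P_def by blast
    qed
    moreover have "emeasure \<mu> G \<le> ennreal M * e"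
    proof -
      have "emeasure \<mu> G \<le> ennreal M * emeasure \<nu> G"
        unfolding G_def
      proof (rule emeasure_Union_dyadic_le[OF sets_mu sets_nu])
        fix k j assume "P k j"
        then show "emeasure \<mu> (dyadic_int k j) \<le> ennreal M * emeasure \<nu> (dyadic_int k j)"
          unfolding emeasure_dyadic_mu emeasure_dyadic_nu
          using assms by (subst ennreal_mult[symmetric]) (auto simp: P_def ennreal_leI)
      qed
      also have "emeasure \<nu> G \<le> emeasure \<nu> U"
        by (rule emeasure_mono) (use U in \<open>auto simp: G_def P_def sets_nu\<close>)
      finally show ?thesis using U(3) by (meson less_imp_le mult_left_mono order_trans zero_le)
    qed
    ultimately show ?thesis by (intro bexI[of _ G]) (auto simp: G_def)
  qed
  \<comment> \<open>Measurability of \<open>E\<close> has not been established, so \<open>E\<close>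
    is enclosed in Borel sets of \<mu>-measure tending to 0, whose intersection is a null
    set.\<close>
  have "\<forall>i::nat. \<exists>G. G \<in> sets borel \<and> E \<subseteq> G \<and> emeasure \<mu> G \<le> ennreal M * ennreal (1 / Suc i)"
  proof
    fix i :: nat
    have "(0 :: ennreal) < ennreal (1 / Suc i)" by simp
    from cover[OF this] show "\<exists>G. G \<in> sets borel \<and> E \<subseteq> G \<and> emeasure \<mu> G \<le> ennreal M * ennreal (1 / Suc i)"
      by blast
  qed
  then obtain G where G: "\<And>i::nat. G i \<in> sets borel" "\<And>i. E \<subseteq> G i"
    "\<And>i. emeasure \<mu> (G i) \<le> ennreal M * ennreal (1 / Suc i)"
    unfolding choice_iff by blast
  have "emeasure \<mu> (\<Inter>i. G i) \<le> ennreal (M * (1 / Suc i))" for i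
  proof -
    have "emeasure \<mu> (\<Inter>i. G i) \<le> emeasure \<mu> (G i)"
      by (rule emeasure_mono) (use G in \<open>auto simp: sets_mu\<close>)
    also have "\<dots> \<le> ennreal M * ennreal (1 / Suc i)" by (rule G)
    finally show ?thesis using assms by (simp add: ennreal_mult[symmetric])
  qed
  moreover have "(\<lambda>i. ennreal (M * (1 / Suc i))) \<longlonglongrightarrow> ennreal (M * 0)"
    by (intro tendsto_ennrealI tendsto_mult_left LIMSEQ_Suc[OF lim_1_over_n])
  ultimately have "emeasure \<mu> (\<Inter>i. G i) \<le> ennreal (M * 0)"
    by (intro Lim_bounded2) auto
  then have "(\<Inter>i. G i) \<in> null_sets \<mu>"
    using G by (auto simp: sets_mu intro!: null_setsI)
  then have "AE x in \<mu>. x \<notin> (\<Inter>i. G i)" by (rule AE_not_in)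
  then show ?thesis
    using AE_mu_unit by eventually_elim (use G in \<open>auto simp: E_def\<close>)
qed

end

theorem mainTheorem1:
  fixes \<mu> \<nu> \<mu>a \<mu>s :: "real measure"
  assumes mu_borel: "sets \<mu> = sets borel" and mu_prob: "prob_space \<mu>"
    and mu_supp: "emeasure \<mu> {0..<1} = 1"
    and nu_borel: "sets \<nu> = sets borel" and nu_prob: "prob_space \<nu>"
    and nu_supp: "emeasure \<nu> {0..<1} = 1"
    and mu_no_atoms: "\<And>j k :: nat. emeasure \<mu> {real j / 2 ^ k} = 0"
    and nu_doubling: "\<exists>C\<ge>1. \<forall>k j. 1 \<le> k \<and> j < 2 ^ k \<longrightarrow>
        measure \<nu> (dyadic_parent k j) \<le> C * measure \<nu> (dyadic_int k j)"
    and a_borel: "sets \<mu>a = sets borel" and s_borel: "sets \<mu>s = sets borel"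
    and decomp: "\<And>A. A \<in> sets borel \<Longrightarrow> emeasure \<mu> A = emeasure \<mu>a A + emeasure \<mu>s A"
    and a_ac: "absolutely_continuous \<nu> \<mu>a"
    and s_sing: "\<exists>N \<in> sets borel. emeasure \<nu> N = 0 \<and> emeasure \<mu>s (UNIV - N) = 0"
  shows "(AE x in \<mu>a. sqfun2 \<mu> \<nu> x < (\<infinity>::ennreal)) \<and> (AE x in \<mu>s. sqfun2 \<mu> \<nu> x = (\<infinity>::ennreal))"
proof -
  obtain C where C: "C \<ge> 1" "\<And>k j. 1 \<le> k \<Longrightarrow> j < 2 ^ k \<Longrightarrow>
      measure \<nu> (dyadic_parent k j) \<le> C * measure \<nu> (dyadic_int k j)"
    using nu_doubling by blast
  interpret dyadic_pair \<mu> \<nu> C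
  proof (rule dyadic_pair.intro)
    show "measure \<nu> (dyadic_int k (j div 2)) \<le> C * measure \<nu> (dyadic_int (Suc k) j)"
      if "j < 2 ^ Suc k" for k j
      using C(2)[of "Suc k" j] that by (simp add: dyadic_parent_def)
  qed fact+
  \<comment> \<open>The parts of the decomposition are dominated by \<mu>, so statements that hold
    \<mu>-almost everywhere pass to both.\<close>
  have null: "N \<in> null_sets \<mu>a" "N \<in> null_sets \<mu>s" if "N \<in> null_sets \<mu>" for N
    using that decomp[of N] by (auto simp: null_sets_def mu_borel a_borel s_borel)
  have AE_a: "AE x in \<mu>a. P x" and AE_s: "AE x in \<mu>s. P x" if P: "AE x in \<mu>. P x" for P
  proof -
    have sp: "space \<mu> = space \<mu>a" "space \<mu> = space \<mu>s"
      using mu_borel a_borel s_borel by (metis sets_eq_imp_space_eq)+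
    obtain N where N: "N \<in> null_sets \<mu>" "{x \<in> space \<mu>. \<not> P x} \<subseteq> N"
      using P by (auto simp: eventually_ae_filter)
    show "AE x in \<mu>a. P x" "AE x in \<mu>s. P x"
      using N null[OF N(1)] sp by (auto simp: eventually_ae_filter)
  qed
  have "AE x in \<mu>a. sqfun2 \<mu> \<nu> x < \<infinity>"
  proof -
    \<comment> \<open>The points where the density exceeds every level. \<open>Suc M\<close> keeps
      the level positive, as \<open>nu_large_ratio_le\<close> requires.\<close>
    define Z where "Z = (\<Inter>M::nat. large_ratio (Suc M))"
    have [measurable]: "Z \<in> sets borel" unfolding Z_def by measurable
    have "emeasure \<nu> Z \<le> ennreal (1 / Suc M)" for M :: nat
    proof -
      have "emeasure \<nu> Z \<le> emeasure \<nu> (large_ratio (Suc M))"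
        by (rule emeasure_mono) (auto simp: Z_def nu_borel)
      also have "\<dots> \<le> ennreal (1 / Suc M)" by (rule nu_large_ratio_le) simp
      finally show ?thesis .
    qed
    moreover have "(\<lambda>M. ennreal (1 / Suc M)) \<longlonglongrightarrow> ennreal 0"
      by (intro tendsto_ennrealI LIMSEQ_Suc[OF lim_1_over_n])
    ultimately have "emeasure \<nu> Z \<le> ennreal 0" by (intro Lim_bounded2) auto
    then have "Z \<in> null_sets \<nu>" by (intro null_setsI) (auto simp: nu_borel)
    then have "AE x in \<mu>a. x \<notin> Z"
      using a_ac by (auto simp: absolutely_continuous_def intro: AE_not_in)
    moreover have "AE x in \<mu>a. \<forall>M::nat. x \<notin> large_ratio (Suc M) \<longrightarrow> sqfun2 \<mu> \<nu> x < \<infinity>"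
      unfolding AE_all_countable by (intro allI AE_a AE_sqfun2_finite) simp
    ultimately show ?thesis by eventually_elim (auto simp: Z_def)
  qed
  moreover have "AE x in \<mu>s. sqfun2 \<mu> \<nu> x = \<infinity>"
  proof -
    obtain N where N: "N \<in> sets borel" "emeasure \<nu> N = 0" "emeasure \<mu>s (UNIV - N) = 0"
      using s_sing by blast
    have "AE x in \<mu>s. x \<notin> UNIV - N"
      using N by (intro AE_not_in null_setsI) (auto simp: s_borel)
    moreover have "AE x in \<mu>s. \<forall>M::nat. x \<in> N \<longrightarrow>
        \<not> (\<exists>\<^sub>F k in sequentially. m k (dyadic_index k x) \<le> M * n k (dyadic_index k x))"
      unfolding AE_all_countable using N by (intro allI AE_s mu_bounded_density_null) simp_all
    \<comment> \<open>A finite square function would bound the density along infinitely many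
      generations, which has just been excluded on \<open>N\<close>, the set carrying
      \<open>\<mu>s\<close>.\<close>
    moreover note AE_s[OF AE_frequently_density_le]
    ultimately show ?thesis by eventually_elim (auto simp: less_top[symmetric])
  qed
  ultimately show ?thesis by blast
qed

end
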